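(* Let $d \in \mathbb{N}$, $\mathfrak{N} \in \mathbb{N}_0$, $T, L \in [0,\infty)$, $\Theta = \bigcup_{n=1}^{\infty} \mathbb{Z}^n$, $\xi \in \mathbb{R}^d$, let $\|\cdot\| \colon \mathbb{R}^d \to [0,\infty)$ be a norm on $\mathbb{R}^d$, let $(S,\mathcal{S})$ be a measurable space, let $F \colon \mathbb{R}^d \times S \to \mathbb{R}^d$ be $(\mathcal{B}(\mathbb{R}^d)\otimes\mathcal{S})/\mathcal{B}(\mathbb{R}^d)$-measurable, and assume for all $x,y \in \mathbb{R}^d$, $s \in S$ that $\|F(x,s)-F(y,s)\| \le L\|x-y\|$. Let $(\Omega,\mathcal{F},\mathbb{P})$ be a probability space, let $Z^\theta \colon \Omega \to S$, $\theta \in \Theta$, be i.i.d. random variables, assume that $\mathbb{E}[\|F(\xi,Z^0)\|^2] < \infty$, let $\mathfrak{r}^\theta \colon \Omega \to [0,1]$, $\theta \in \Theta$, be independent random variables, each uniformly distributed on $[0,1]$, let $\mathcal{R}^\theta \colon [0,T]\times\Omega \to [0,T]$, $\theta \in \Theta$, satisfy for all $t \in [0,T]$, $\theta \in \Theta$ that $\mathcal{R}^\theta_t = \mathfrak{r}^\theta t$, assume that $(\mathfrak{r}^\theta)_{\theta\in\Theta}$ and $(Z^\theta)_{\theta\in\Theta}$ are independent, let $\mathcal{X}^\theta_{n,m} \colon [0,T]\times\Omega \to \mathbb{R}^d$, $n,m \in \mathbb{N}_0$, $\theta \in \Theta$, satisfy for all $n \in \mathbb{N}_0$, $m \in \mathbb{N}$,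 $\theta \in \Theta$, $t \in [0,T]$ that $$\mathcal{X}^\theta_{n,m}(t) = \Bigg[\sum_{l=1}^{n-1} \frac{t}{m^{n-l}} \sum_{k=1}^{m^{n-l}} \Big( F\big(\mathcal{X}^{(\theta,l,k)}_{l,m}(\mathcal{R}^{(\theta,l,k)}_t), Z^{(\theta,l,k)}\big) - F\big(\mathcal{X}^{(\theta,l,-k)}_{l-1,m}(\mathcal{R}^{(\theta,l,k)}_t), Z^{(\theta,l,k)}\big)\Big)\Bigg] + \Bigg[\frac{t\,\mathbf{1}_{\mathbb{N}}(n)}{m^n}\sum_{k=1}^{m^n} F\big(\xi,Z^{(\theta,0,k)}\big)\Bigg] + \xi,$$ and let $(RV_{n,m})_{n\in\mathbb{N}_0,m\in\mathbb{N}} \subseteq \mathbb{N}_0$ satisfy for all $n,m \in \mathbb{N}$ that $RV_{0,m} = 0$ and $$RV_{n,m} \le m^n + \sum_{l=1}^{n-1}\big[m^{n-l}(1+RV_{l,m}+RV_{l-1,m})\big].$$ Then: (i) there exists a unique $X \in C([0,T],\mathbb{R}^d)$ such that for all $t \in [0,T]$ it holds that $X(t) = \xi + \int_0^t \mathbb{E}[F(X(r),Z^0)]\,dr$; and (ii) (with this $X$) there exist $c = (c_\delta)_{\delta\in(0,\infty)} \colon (0,\infty) \to [0,\infty)$ and $N = (N_\varepsilon)_{\varepsilon\in(0,1]} \colon (0,1] \to \mathbb{N}$ such that for all $\delta \in (0,\infty)$, $\varepsilon \in (0,1]$ it holds that $$\sum_{n=1}^{N_\varepsilon+\mathfrak{N}}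 RV_{n,n} \le c_\delta\,\varepsilon^{-(2+\delta)} \qquad\text{and}\qquad \sup_{n\in[N_\varepsilon,\infty)\cap\mathbb{N}} \big(\mathbb{E}[\|X(T)-\mathcal{X}^0_{n,n}(T)\|^2]\big)^{1/2} \le \varepsilon.$$
   Context: $\mathbb{N}=\{1,2,3,\dots\}$ and $\mathbb{N}_0=\mathbb{N}\cup\{0\}$. $\mathbf{1}_{\mathbb{N}}(n)$ equals $1$ if $n\ge 1$ and $0$ if $n=0$; empty sums are $0$. The index $0$ in $Z^0$, $\mathcal{X}^0_{n,m}$ is the element $0\in\mathbb{Z}^1\subseteq\Theta$. For $\theta=(\theta_1,\dots,\theta_j)\in\mathbb{Z}^j$ and $l,k\in\mathbb{Z}$, $(\theta,l,k)$ denotes the concatenation $(\theta_1,\dots,\theta_j,l,k)\in\mathbb{Z}^{j+2}\subseteq\Theta$. $\mathcal{B}(\cdot)$ denotes the Borel sigma-algebra. Under the stated hypotheses, for every $X\in C([0,T],\mathbb{R}^d)$ the quantity $\mathbb{E}[\|F(X(r),Z^0)\|]$ is finite and integrable in $r\in[0,T]$, so the integral in (i) is meaningful. ($RV_{n,m}$ models the number of realizations of the random variables $Z^\theta$ needed to compute one realization of $\mathcal{X}^0_{n,m}(T)$.) *)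

theory Defs
  imports "HOL-Probability.Probability"
begin

definition is_norm :: "('a::real_vector \<Rightarrow> real) \<Rightarrow> bool" where
  "is_norm N \<longleftrightarrow>
     (\<forall>x. 0 \<le> N x) \<and>
     (\<forall>x. N x = 0 \<longleftrightarrow> x = 0) \<and>
     (\<forall>a x. N (a *\<^sub>R x) = \<bar>a\<bar> * N x) \<and>
     (\<forall>x y. N (x + y) \<le> N x + N y)"

(* The disjoint union of the sets Z^n, n >= 1: a tuple is a nonempty list, so the index 0 is [0]
   and the concatenation (theta, l, k) is theta @ [l, k]. *)
definition Theta :: "int list set" where
  "Theta = (\<Union>n\<in>{1..}. {\<theta>. length \<theta> = n})"

(* Functions with domain {0..T}: extensionality fixes the (irrelevant) values outside the
   interval, so that equality of elements is equality of functions on {0..T}. *)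
definition cont_paths :: "real \<Rightarrow> (real \<Rightarrow> 'a::topological_space) set" where
  "cont_paths T = {X \<in> extensional {0..T}. continuous_on {0..T} X}"

(* prob_space.indep_var requires both random variables to have the same value type; this is
   the characterization indep_var_eq without that restriction. *)
definition indep_rvs ::
  "'w measure \<Rightarrow> 'a measure \<Rightarrow> ('w \<Rightarrow> 'a) \<Rightarrow> 'b measure \<Rightarrow> ('w \<Rightarrow> 'b) \<Rightarrow> bool" where
  "indep_rvs P M X N Y \<longleftrightarrow>
     X \<in> P \<rightarrow>\<^sub>M M \<and> Y \<in> P \<rightarrow>\<^sub>M N \<and>
     prob_space.indep_set P
       (sigma_sets (space P) {X -` A \<inter> space P |A. A \<in> sets M})
       (sigma_sets (space P) {Y -` B \<inter> space P |B. B \<in> sets N})"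

(* The square root on [0, infinity]. *)
definition ennsqrt :: "ennreal \<Rightarrow> ennreal" where
  "ennsqrt x = (if x = \<infinity> then \<infinity> else ennreal (sqrt (enn2real x)))"

end

theory Submission
  imports Defs "HOL-Real_Asymp.Real_Asymp"
begin

text \<open>
  Replacing the norm by the Euclidean one costs only constants. Each \<open>\<X>\<^sup>\<theta>\<^sub>n\<^sub>,\<^sub>m(t)\<close> is a fixed
  measurable function of the data at the proper extensions of \<open>\<theta>\<close>, so its error
  \<open>e\<^sub>n(t) = E \<parallel>\<X>\<^sup>\<theta>\<^sub>n\<^sub>,\<^sub>m(t) - X(t)\<parallel>\<^sup>2\<close> does not depend on \<open>\<theta>\<close>, and the summands
  of the recursion live on disjoint blocks of data. Their means telescope, so splitting the error into
  bias and variance bounds \<open>e\<^sub>n(t)\<close> in terms of the averages of \<open>e\<^sub>l\<close> over \<open>[0,t]\<close>, \<open>l < n\<close>.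
  Inserting \<open>e\<^sub>l(s) \<le> B \<kappa>\<^sup>l m\<^sup>-\<^sup>l exp(m s)\<close>, each average over \<open>[0,t]\<close> gains the factor
  \<open>1/m\<close>, and the bound reproduces itself. With \<open>m = n\<close> the squared error is at most
  \<open>D G\<^sup>n n\<^sup>-\<^sup>n\<close> while the cost is at most \<open>(4n)\<^sup>n\<close>; taking \<open>N\<^sub>\<epsilon>\<close> minimal,
  the error at \<open>N\<^sub>\<epsilon> - 1\<close> still exceeds \<open>\<epsilon>\<close>, and any extra \<open>\<delta>\<close> absorbs all
  factors of the form \<open>C\<^sup>n\<close>.
\<close>

section \<open>Independence\<close>

text \<open>Why the weight exp(m s) appears: the correction at level \<open>l\<close> compares
  approximations of levels \<open>l\<close> and \<open>l - 1\<close>, so its mean square is only of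
  order \<open>m^(-(l-1))\<close>, and averaging its samples contributes \<open>m^(-(n-l))\<close>.
  Together this misses \<open>m^(-n)\<close> by one factor \<open>m\<close>. At a random time s = r
  t with r uniform on [0,1], the mean of exp(m s) is at most exp(m t)/(m t), which supplies the
  missing factor. The price exp(m T) is affordable because for m = n it is the n-th power of exp(T).

  The two approximations inside one summand share the time and the realization of Z at node (l,k),
  while their own data come from (l,k) and (l,-k). Comparing both with \<open>F\<close> at the exact
  solution, for the same time and the same realization, makes the exact term cancel and leaves only
  errors of lower levels.

  Square integrability of the iterates is not known beforehand. Errors are therefore nonnegative
  extended integrals, and each step of the induction delivers integrability together with the
  bound.\<close>

lemma (in prob_space) indep_vars_reindex:
  assumes inj: "inj_on f I" and ind: "indep_vars M' X (f ` I)"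
  shows "indep_vars (\<lambda>i. M' (f i)) (\<lambda>i. X (f i)) I"
  unfolding indep_vars_def2
proof (intro conjI ballI indep_setsI)
  show rv: "random_variable (M' (f i)) (X (f i))" if "i \<in> I" for i
    using ind that by (auto simp: indep_vars_def2)
  show "{X (f i) -` A \<inter> space M |A. A \<in> sets (M' (f i))} \<subseteq> events" if "i \<in> I" for i
    using rv[OF that] by (auto intro: measurable_sets)
next
  fix A J
  assume J: "J \<noteq> {}" "J \<subseteq> I" "finite J"
    and A: "\<forall>j\<in>J. A j \<in> {X (f j) -` A \<inter> space M |A. A \<in> sets (M' (f j))}"
  have injJ: "inj_on f J" using inj J(2) by (rule inj_on_subset)
  define g where "g = the_inv_into J f"
  have g: "g (f j) = j" if "j \<in> J" for j
    unfolding g_def using injJ that by (rule the_inv_into_f_f)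
  have "prob (\<Inter>j\<in>f ` J. A (g j)) = (\<Prod>j\<in>f ` J. prob (A (g j)))"
    using ind J A g unfolding indep_vars_def2
    by (intro indep_setsD[where F="\<lambda>i. {X i -` A \<inter> space M |A. A \<in> sets (M' i)}" and I="f ` I"]) auto
  then show "prob (\<Inter>j\<in>J. A j) = (\<Prod>j\<in>J. prob (A j))"
    using g by (simp add: prod.reindex[OF injJ] cong: INF_cong_simp)
qed

text \<open>\<open>indep_rvs\<close> speaks only of preimages under a whole family. Finitely many
  conditions on single members become one such preimage, namely that of a cylinder set.\<close>

lemma INT_vimage_eq_prod_emb:
  assumes J: "J \<noteq> {}" "J \<subseteq> I" and X: "\<And>i. i \<in> I \<Longrightarrow> X i \<in> M \<rightarrow>\<^sub>M M' i"
  shows "(\<Inter>j\<in>J. X j -` A j \<inter> space M) =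
    (\<lambda>\<omega>. \<lambda>i\<in>I. X i \<omega>) -` (prod_emb I M' J (Pi\<^sub>E J A)) \<inter> space M"
proof (rule set_eqI)
  fix \<omega>
  have *: "(\<lambda>i\<in>I. X i \<omega>) \<in> (\<Pi>\<^sub>E i\<in>I. space (M' i))" if "\<omega> \<in> space M"
    using X[THEN measurable_space, OF _ that] by auto
  have **: "restrict (\<lambda>i\<in>I. X i \<omega>) J \<in> Pi\<^sub>E J A \<longleftrightarrow> (\<forall>j\<in>J. X j \<omega> \<in> A j)"
    using J(2) by (auto simp: PiE_iff)
  show "\<omega> \<in> (\<Inter>j\<in>J. X j -` A j \<inter> space M) \<longleftrightarrow>
    \<omega> \<in> (\<lambda>\<omega>. \<lambda>i\<in>I. X i \<omega>) -` (prod_emb I M' J (Pi\<^sub>E J A)) \<inter> space M"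
    unfolding prod_emb_def using * ** J(1) by (simp add: Bex_def) blast
qed

text \<open>It suffices to test intersection-stable generators, the rectangle events. There the
  probability factors first between the two families, then inside each family, and the factors of
  one index are finally recombined by the first factorization applied to that index alone.\<close>

lemma (in prob_space) indep_vars_Pair:
  assumes X: "indep_vars M' X I" and Y: "indep_vars N' Y I"
    and XY: "indep_rvs M (\<Pi>\<^sub>M i\<in>I. M' i) (\<lambda>\<omega>. \<lambda>i\<in>I. X i \<omega>) (\<Pi>\<^sub>M i\<in>I. N' i) (\<lambda>\<omega>. \<lambda>i\<in>I. Y i \<omega>)"
  shows "indep_vars (\<lambda>i. M' i \<Otimes>\<^sub>M N' i) (\<lambda>i \<omega>. (X i \<omega>, Y i \<omega>)) I"
proof -
  have rvX: "random_variable (M' i) (X i)" and rvY: "random_variable (N' i) (Y i)" if "i \<in> I" for i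
    using X Y that by (auto simp: indep_vars_def2)
  define G where "G i = {(X i -` A \<inter> space M) \<inter> (Y i -` B \<inter> space M) |A B. A \<in> sets (M' i) \<and> B \<in> sets (N' i)}" for i
  have split: "prob ((\<Inter>j\<in>J. X j -` A j \<inter> space M) \<inter> (\<Inter>j\<in>J. Y j -` B j \<inter> space M))
      = prob (\<Inter>j\<in>J. X j -` A j \<inter> space M) * prob (\<Inter>j\<in>J. Y j -` B j \<inter> space M)"
    if J: "J \<noteq> {}" "J \<subseteq> I" "finite J" and A: "\<And>j. j \<in> J \<Longrightarrow> A j \<in> sets (M' j)"
      and B: "\<And>j. j \<in> J \<Longrightarrow> B j \<in> sets (N' j)" for A B J
  proof -
    have eq1: "(\<Inter>j\<in>J. X j -` A j \<inter> space M) =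
        (\<lambda>\<omega>. \<lambda>i\<in>I. X i \<omega>) -` (prod_emb I M' J (Pi\<^sub>E J A)) \<inter> space M"
      using J rvX by (intro INT_vimage_eq_prod_emb)
    have eq2: "(\<Inter>j\<in>J. Y j -` B j \<inter> space M) =
        (\<lambda>\<omega>. \<lambda>i\<in>I. Y i \<omega>) -` (prod_emb I N' J (Pi\<^sub>E J B)) \<inter> space M"
      using J rvY by (intro INT_vimage_eq_prod_emb)
    have "prod_emb I M' J (Pi\<^sub>E J A) \<in> sets (\<Pi>\<^sub>M i\<in>I. M' i)"
      using J A by (intro sets_PiM_I) auto
    moreover have "prod_emb I N' J (Pi\<^sub>E J B) \<in> sets (\<Pi>\<^sub>M i\<in>I. N' i)"
      using J B by (intro sets_PiM_I) auto
    ultimately show ?thesis using eq1 eq2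
      by (intro indep_setD[OF XY[unfolded indep_rvs_def, THEN conjunct2, THEN conjunct2]] sigma_sets.Basic) blast+
  qed
  have Gev: "G i \<subseteq> events" if "i \<in> I" for i
  proof
    fix C assume "C \<in> G i"
    then obtain A B where "C = (X i -` A \<inter> space M) \<inter> (Y i -` B \<inter> space M)" "A \<in> sets (M' i)" "B \<in> sets (N' i)"
      unfolding G_def by blast
    then show "C \<in> events"
      using measurable_sets[OF rvX[OF that]] measurable_sets[OF rvY[OF that]] by blast
  qed
  have indG: "indep_sets G I"
  proof (rule indep_setsI)
    fix C J assume J: "J \<noteq> {}" "J \<subseteq> I" "finite J" and C: "\<forall>j\<in>J. C j \<in> G j"
    have "\<forall>j\<in>J. \<exists>AB. fst AB \<in> sets (M' j) \<and> snd AB \<in> sets (N' j) \<and>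
        C j = (X j -` fst AB \<inter> space M) \<inter> (Y j -` snd AB \<inter> space M)"
    proof
      fix j assume "j \<in> J"
      with C have "C j \<in> G j" by (rule bspec)
      then obtain A B where "C j = (X j -` A \<inter> space M) \<inter> (Y j -` B \<inter> space M)" "A \<in> sets (M' j)" "B \<in> sets (N' j)"
        unfolding G_def by (elim CollectE exE conjE)
      then show "\<exists>AB. fst AB \<in> sets (M' j) \<and> snd AB \<in> sets (N' j) \<and>
        C j = (X j -` fst AB \<inter> space M) \<inter> (Y j -` snd AB \<inter> space M)"
        by (intro exI[of _ "(A, B)"]) simp
    qed
    from bchoice[OF this] obtain AB where AB': "\<forall>j\<in>J. fst (AB j) \<in> sets (M' j) \<and> snd (AB j) \<in> sets (N' j) \<and>
        C j = (X j -` fst (AB j) \<inter> space M) \<inter> (Y j -` snd (AB j) \<inter> space M)" ..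
    define A B where "A j = fst (AB j)" and "B j = snd (AB j)" for j
    have AB: "\<And>j. j \<in> J \<Longrightarrow> A j \<in> sets (M' j)" "\<And>j. j \<in> J \<Longrightarrow> B j \<in> sets (N' j)"
      "\<And>j. j \<in> J \<Longrightarrow> C j = (X j -` A j \<inter> space M) \<inter> (Y j -` B j \<inter> space M)"
      using AB' unfolding A_def B_def by simp_all
    have "(\<Inter>j\<in>J. C j) = (\<Inter>j\<in>J. X j -` A j \<inter> space M) \<inter> (\<Inter>j\<in>J. Y j -` B j \<inter> space M)"
      using AB(3) by auto
    then have "prob (\<Inter>j\<in>J. C j) = prob (\<Inter>j\<in>J. X j -` A j \<inter> space M) * prob (\<Inter>j\<in>J. Y j -` B j \<inter> space M)"
      using split[OF J, of A B] AB by simp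
    also have "prob (\<Inter>j\<in>J. X j -` A j \<inter> space M) = (\<Prod>j\<in>J. prob (X j -` A j \<inter> space M))"
      using X J AB by (intro indep_setsD[where F="\<lambda>i. {X i -` A \<inter> space M |A. A \<in> sets (M' i)}" and I=I])
        (auto simp: indep_vars_def2)
    also have "prob (\<Inter>j\<in>J. Y j -` B j \<inter> space M) = (\<Prod>j\<in>J. prob (Y j -` B j \<inter> space M))"
      using Y J AB by (intro indep_setsD[where F="\<lambda>i. {Y i -` A \<inter> space M |A. A \<in> sets (N' i)}" and I=I])
        (auto simp: indep_vars_def2)
    also have "(\<Prod>j\<in>J. prob (X j -` A j \<inter> space M)) * (\<Prod>j\<in>J. prob (Y j -` B j \<inter> space M))
        = (\<Prod>j\<in>J. prob (C j))"
      unfolding prod.distrib[symmetric]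
    proof (intro prod.cong refl)
      fix j assume "j \<in> J"
      then show "prob (X j -` A j \<inter> space M) * prob (Y j -` B j \<inter> space M) = prob (C j)"
        using split[of "{j}" A B] J(2) AB[of j] by (simp add: subset_iff)
    qed
    finally show "prob (\<Inter>j\<in>J. C j) = (\<Prod>j\<in>J. prob (C j))" .
  qed (rule Gev)
  have "indep_sets (\<lambda>i. sigma_sets (space M) (G i)) I"
  proof (rule indep_sets_sigma[OF indG])
    fix i assume "i \<in> I"
    show "Int_stable (G i)" unfolding Int_stable_def G_def
    proof clarify
      fix A B A' B' assume "A \<in> sets (M' i)" "B \<in> sets (N' i)" "A' \<in> sets (M' i)" "B' \<in> sets (N' i)"
      then show "\<exists>A'' B''. X i -` A \<inter> space M \<inter> (Y i -` B \<inter> space M) \<inter> (X i -` A' \<inter> space M \<inter> (Y i -` B' \<inter> space M)) =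
           X i -` A'' \<inter> space M \<inter> (Y i -` B'' \<inter> space M) \<and> A'' \<in> sets (M' i) \<and> B'' \<in> sets (N' i)"
        by (intro exI[of _ "A \<inter> A'"] exI[of _ "B \<inter> B'"]) auto
    qed
  qed
  moreover have "sigma_sets (space M) {(\<lambda>\<omega>. (X i \<omega>, Y i \<omega>)) -` A \<inter> space M |A. A \<in> sets (M' i \<Otimes>\<^sub>M N' i)}
      \<subseteq> sigma_sets (space M) (G i)" if i: "i \<in> I" for i
  proof (rule sigma_sets_mono, safe)
    fix A assume A: "A \<in> sets (M' i \<Otimes>\<^sub>M N' i)"
    \<comment> \<open>The source is the sigma-algebra generated by the rectangle events, not that of
      \<open>M\<close>: the pair must be measurable with respect to what
      \<open>indep_sets_sigma\<close> covers.\<close>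
    have "(\<lambda>\<omega>. (X i \<omega>, Y i \<omega>)) \<in> sigma (space M) (G i) \<rightarrow>\<^sub>M M' i \<Otimes>\<^sub>M N' i"
    proof -
      have G_sub: "G i \<subseteq> Pow (space M)" by (auto simp: G_def)
      have "(\<lambda>\<omega>. (X i \<omega>, Y i \<omega>)) \<in> sigma (space M) (G i) \<rightarrow>\<^sub>M
          sigma (space (M' i) \<times> space (N' i)) {a \<times> b |a b. a \<in> sets (M' i) \<and> b \<in> sets (N' i)}"
      proof (rule measurable_measure_of)
        show "{a \<times> b |a b. a \<in> sets (M' i) \<and> b \<in> sets (N' i)} \<subseteq> Pow (space (M' i) \<times> space (N' i))"
          by (rule pair_measure_closed)
        show "(\<lambda>\<omega>. (X i \<omega>, Y i \<omega>)) \<in> space (sigma (space M) (G i)) \<rightarrow> space (M' i) \<times> space (N' i)"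
          using G_sub rvX[OF i, THEN measurable_space] rvY[OF i, THEN measurable_space] by (auto simp: space_measure_of_conv)
        fix y assume "y \<in> {a \<times> b |a b. a \<in> sets (M' i) \<and> b \<in> sets (N' i)}"
        then obtain a b where y: "y = a \<times> b" "a \<in> sets (M' i)" "b \<in> sets (N' i)" by auto
        have "(\<lambda>\<omega>. (X i \<omega>, Y i \<omega>)) -` y \<inter> space (sigma (space M) (G i)) = (X i -` a \<inter> space M) \<inter> (Y i -` b \<inter> space M)"
          using y by (auto simp: space_measure_of_conv)
        then show "(\<lambda>\<omega>. (X i \<omega>, Y i \<omega>)) -` y \<inter> space (sigma (space M) (G i)) \<in> sets (sigma (space M) (G i))"
          using y G_sub by (auto simp: G_def)
      qed
      then show ?thesis unfolding pair_measure_def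
        by (simp add: measurable_def space_measure_of_conv sets_measure_of_conv pair_measure_closed)
    qed
    from measurable_sets[OF this A] show "(\<lambda>\<omega>. (X i \<omega>, Y i \<omega>)) -` A \<inter> space M \<in> sigma_sets (space M) (G i)"
      by (subst (asm) sets_measure_of) (auto simp: G_def space_measure_of_conv)
  qed
  ultimately show ?thesis
    unfolding indep_vars_def using rvX rvY
    by (intro conjI ballI measurable_Pair) (simp_all add: indep_sets_mono_sets)
qed

section \<open>Second moments of sums of independent vectors\<close>

lemma (in prob_space) expectation_inner_indep:
  fixes X Y :: "'a \<Rightarrow> 'b::euclidean_space"
  assumes "indep_var borel X borel Y" and X: "integrable M X" and Y: "integrable M Y"
  shows "integrable M (\<lambda>\<omega>. X \<omega> \<bullet> Y \<omega>)"
    and "expectation (\<lambda>\<omega>. X \<omega> \<bullet> Y \<omega>) = expectation X \<bullet> expectation Y"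
proof -
  have ind: "indep_var borel (\<lambda>\<omega>. X \<omega> \<bullet> b) borel (\<lambda>\<omega>. Y \<omega> \<bullet> b)" for b
    using indep_var_compose[OF assms(1), of "\<lambda>x. x \<bullet> b" borel "\<lambda>x. x \<bullet> b" borel] by (simp add: comp_def)
  have i: "integrable M (\<lambda>\<omega>. (X \<omega> \<bullet> b) * (Y \<omega> \<bullet> b))" for b
    using X Y by (intro indep_var_integrable[OF ind]) auto
  have e: "expectation (\<lambda>\<omega>. (X \<omega> \<bullet> b) * (Y \<omega> \<bullet> b)) = (expectation X \<bullet> b) * (expectation Y \<bullet> b)" for b
    using X Y by (subst indep_var_lebesgue_integral[OF ind]) auto
  show "integrable M (\<lambda>\<omega>. X \<omega> \<bullet> Y \<omega>)"
    by (subst euclidean_inner) (intro Bochner_Integration.integrable_sum i)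
  show "expectation (\<lambda>\<omega>. X \<omega> \<bullet> Y \<omega>) = expectation X \<bullet> expectation Y"
    by (subst (1 2) euclidean_inner) (simp add: i e)
qed

lemma (in prob_space) integrable_norm_sq:
  fixes X :: "'a \<Rightarrow> 'b::euclidean_space"
  assumes [measurable]: "random_variable borel X" and sq: "integrable M (\<lambda>\<omega>. (norm (X \<omega>))\<^sup>2)"
  shows "integrable M X"
proof (rule Bochner_Integration.integrable_bound)
  show "integrable M (\<lambda>\<omega>. 1 + (norm (X \<omega>))\<^sup>2)" using sq by simp
  have "norm (X \<omega>) \<le> 1 + (norm (X \<omega>))\<^sup>2" for \<omega>
    using zero_le_power2[of "norm (X \<omega>) - 1"] norm_ge_zero[of "X \<omega>"] unfolding power2_diff
    by (simp del: zero_le_power2 norm_ge_zero add: algebra_simps)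
  then show "AE \<omega> in M. norm (X \<omega>) \<le> norm (1 + (norm (X \<omega>))\<^sup>2)" by simp
qed simp

text \<open>Adding an index \<open>a\<close> splits the vector into the centered part
  \<open>X a - \<mu>\<close> and a remainder in which \<open>\<mu>\<close> has joined the offset
  \<open>v\<close>; this is why \<open>v\<close> varies in the induction. The cross term vanishes
  because \<open>X a\<close> is centered and independent of each other summand, and centering does
  not increase the second moment.\<close>

lemma (in prob_space) bias_variance_indep_sum:
  fixes X :: "'i \<Rightarrow> 'a \<Rightarrow> 'b::euclidean_space"
  assumes "finite I"
    and "\<And>i j. i \<in> I \<Longrightarrow> j \<in> I \<Longrightarrow> i \<noteq> j \<Longrightarrow> indep_var borel (X i) borel (X j)"
    and "\<And>i. i \<in> I \<Longrightarrow> random_variable borel (X i)"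
    and "\<And>i. i \<in> I \<Longrightarrow> integrable M (\<lambda>\<omega>. (norm (X i \<omega>))\<^sup>2)"
  shows "integrable M (\<lambda>\<omega>. (norm ((\<Sum>i\<in>I. X i \<omega>) + v))\<^sup>2) \<and>
    expectation (\<lambda>\<omega>. (norm ((\<Sum>i\<in>I. X i \<omega>) + v))\<^sup>2)
      \<le> (\<Sum>i\<in>I. expectation (\<lambda>\<omega>. (norm (X i \<omega>))\<^sup>2)) + (norm ((\<Sum>i\<in>I. expectation (X i)) + v))\<^sup>2"
  using assms
proof (induction I arbitrary: v rule: finite_induct)
  case empty
  then show ?case by (simp add: prob_space)
next
  case (insert a I)
  define \<mu> where "\<mu> = expectation (X a)"
  define S where "S \<omega> = (\<Sum>i\<in>I. X i \<omega>) + (\<mu> + v)" for \<omega>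
  have IH: "integrable M (\<lambda>\<omega>. (norm (S \<omega>))\<^sup>2)"
    "expectation (\<lambda>\<omega>. (norm (S \<omega>))\<^sup>2) \<le> (\<Sum>i\<in>I. expectation (\<lambda>\<omega>. (norm (X i \<omega>))\<^sup>2))
       + (norm ((\<Sum>i\<in>I. expectation (X i)) + (\<mu> + v)))\<^sup>2"
    using insert.IH[of "\<mu> + v"] insert.prems unfolding S_def by auto
  have int: "integrable M (X i)" if "i \<in> insert a I" for i
    using insert.prems(2,3)[OF that] by (rule integrable_norm_sq)
  have sqa: "integrable M (\<lambda>\<omega>. (norm (X a \<omega>))\<^sup>2)" using insert.prems(3)[of a] by blast
  have cross_i: "integrable M (\<lambda>\<omega>. (X a \<omega> - \<mu>) \<bullet> X i \<omega>)"
    "expectation (\<lambda>\<omega>. (X a \<omega> - \<mu>) \<bullet> X i \<omega>) = 0" if "i \<in> I" for i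
  proof -
    have ind: "indep_var borel (X a) borel (X i)"
      using insert.prems(1)[of a i] insert.hyps that by blast
    note * = expectation_inner_indep[OF ind int[OF insertI1] int[OF insertI2[OF that]]]
    show "integrable M (\<lambda>\<omega>. (X a \<omega> - \<mu>) \<bullet> X i \<omega>)"
      using *(1) int[of i] that by (simp add: inner_diff_left)
    show "expectation (\<lambda>\<omega>. (X a \<omega> - \<mu>) \<bullet> X i \<omega>) = 0"
      using *(1,2) int[of i] that by (simp add: inner_diff_left \<mu>_def)
  qed
  have centered: "integrable M (\<lambda>\<omega>. X a \<omega> - \<mu>)" "expectation (\<lambda>\<omega>. X a \<omega> - \<mu>) = 0"
    using int[of a] by (auto simp: \<mu>_def prob_space)
  have cross: "integrable M (\<lambda>\<omega>. (X a \<omega> - \<mu>) \<bullet> S \<omega>)" "expectation (\<lambda>\<omega>. (X a \<omega> - \<mu>) \<bullet> S \<omega>) = 0"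
    unfolding S_def inner_add_right[where y="\<Sum>i\<in>I. X i _"] inner_sum_right
    using cross_i centered by (auto simp: inner_sum_right)
  have sqc_eq: "(norm (X a \<omega> - \<mu>))\<^sup>2 = (norm (X a \<omega>))\<^sup>2 - 2 * (X a \<omega> \<bullet> \<mu>) + (norm \<mu>)\<^sup>2" for \<omega>
    by (simp add: power2_norm_eq_inner inner_diff_left inner_diff_right inner_commute)
  have sqc: "integrable M (\<lambda>\<omega>. (norm (X a \<omega> - \<mu>))\<^sup>2)"
    unfolding sqc_eq using sqa int[of a] by simp
  have "expectation (\<lambda>\<omega>. (norm (X a \<omega> - \<mu>))\<^sup>2) = expectation (\<lambda>\<omega>. (norm (X a \<omega>))\<^sup>2) - (norm \<mu>)\<^sup>2"
    unfolding sqc_eq using sqa int[of a]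
    by (simp add: prob_space \<mu>_def[symmetric] power2_norm_eq_inner)
  then have sqc_le: "expectation (\<lambda>\<omega>. (norm (X a \<omega> - \<mu>))\<^sup>2) \<le> expectation (\<lambda>\<omega>. (norm (X a \<omega>))\<^sup>2)"
    by simp
  have eq: "(norm ((\<Sum>i\<in>insert a I. X i \<omega>) + v))\<^sup>2
      = (norm (X a \<omega> - \<mu>))\<^sup>2 + 2 * ((X a \<omega> - \<mu>) \<bullet> S \<omega>) + (norm (S \<omega>))\<^sup>2" for \<omega>
  proof -
    have "(\<Sum>i\<in>insert a I. X i \<omega>) + v = (X a \<omega> - \<mu>) + S \<omega>"
      using insert.hyps by (simp add: S_def algebra_simps)
    then show ?thesis
      by (simp add: power2_norm_eq_inner inner_add_left inner_add_right inner_commute)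
  qed
  have e1: "expectation (\<lambda>\<omega>. (norm (X a \<omega> - \<mu>))\<^sup>2 + 2 * ((X a \<omega> - \<mu>) \<bullet> S \<omega>) + (norm (S \<omega>))\<^sup>2)
      = expectation (\<lambda>\<omega>. (norm (X a \<omega> - \<mu>))\<^sup>2) + expectation (\<lambda>\<omega>. (norm (S \<omega>))\<^sup>2)"
    using sqc cross IH(1) by simp
  have e2: "(\<Sum>i\<in>insert a I. expectation (X i)) + v = (\<Sum>i\<in>I. expectation (X i)) + (\<mu> + v)"
    using insert.hyps by (simp add: \<mu>_def add.assoc add.left_commute)
  have e3: "integrable M (\<lambda>\<omega>. (norm (X a \<omega> - \<mu>))\<^sup>2 + 2 * ((X a \<omega> - \<mu>) \<bullet> S \<omega>) + (norm (S \<omega>))\<^sup>2)"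
    using sqc cross(1) IH(1) by simp
  have e4: "(\<Sum>i\<in>insert a I. expectation (\<lambda>\<omega>. (norm (X i \<omega>))\<^sup>2))
      = expectation (\<lambda>\<omega>. (norm (X a \<omega>))\<^sup>2) + (\<Sum>i\<in>I. expectation (\<lambda>\<omega>. (norm (X i \<omega>))\<^sup>2))"
    by (rule sum.insert[OF insert.hyps])
  show ?case unfolding eq e2 e4 using e1 e3 IH(2) sqc_le
    by (intro conjI; (assumption | linarith))
qed

text \<open>The library rule \<open>indep_var_distribution_eq\<close> requires both variables to have the same value type.\<close>

lemma (in prob_space) distr_Pair_indep_rvs_component:
  assumes XY: "indep_rvs M (\<Pi>\<^sub>M i\<in>I. M' i) (\<lambda>\<omega>. \<lambda>i\<in>I. X i \<omega>) (\<Pi>\<^sub>M i\<in>I. N' i) (\<lambda>\<omega>. \<lambda>i\<in>I. Y i \<omega>)"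
    and i: "i \<in> I"
  shows "distr M (M' i \<Otimes>\<^sub>M N' i) (\<lambda>\<omega>. (X i \<omega>, Y i \<omega>)) = distr M (M' i) (X i) \<Otimes>\<^sub>M distr M (N' i) (Y i)"
proof (rule pair_measure_eqI[symmetric])
  let ?X = "\<lambda>\<omega>. \<lambda>i\<in>I. X i \<omega>" and ?Y = "\<lambda>\<omega>. \<lambda>i\<in>I. Y i \<omega>"
  have mX: "?X \<in> M \<rightarrow>\<^sub>M PiM I M'" and mY: "?Y \<in> M \<rightarrow>\<^sub>M PiM I N'"
    and ind: "indep_set (sigma_sets (space M) {?X -` A \<inter> space M |A. A \<in> sets (PiM I M')})
      (sigma_sets (space M) {?Y -` B \<inter> space M |B. B \<in> sets (PiM I N')})"
    using XY by (auto simp: indep_rvs_def)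
  have [measurable]: "X i \<in> M \<rightarrow>\<^sub>M M' i" "Y i \<in> M \<rightarrow>\<^sub>M N' i"
    using measurable_compose[OF mX measurable_component_singleton[OF i]]
      measurable_compose[OF mY measurable_component_singleton[OF i]] i by simp_all
  show "sigma_finite_measure (distr M (M' i) (X i))" "sigma_finite_measure (distr M (N' i) (Y i))"
    by (intro prob_space_imp_sigma_finite prob_space_distr; measurable)+
  show "sets (distr M (M' i) (X i) \<Otimes>\<^sub>M distr M (N' i) (Y i)) = sets (distr M (M' i \<Otimes>\<^sub>M N' i) (\<lambda>\<omega>. (X i \<omega>, Y i \<omega>)))"
    by (simp cong: sets_pair_measure_cong)
  fix A B assume "A \<in> sets (distr M (M' i) (X i))" "B \<in> sets (distr M (N' i) (Y i))"
  then have A: "A \<in> sets (M' i)" and B: "B \<in> sets (N' i)" by auto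
  have evA: "X i -` A \<inter> space M \<in> sigma_sets (space M) {?X -` A \<inter> space M |A. A \<in> sets (PiM I M')}"
  proof (rule sigma_sets.Basic, intro CollectI exI conjI)
    show "(\<lambda>u. u i) -` A \<inter> space (PiM I M') \<in> sets (PiM I M')"
      by (rule measurable_sets[OF measurable_component_singleton[OF i, of M'] A])
    show "X i -` A \<inter> space M = ?X -` ((\<lambda>u. u i) -` A \<inter> space (PiM I M')) \<inter> space M"
      using measurable_space[OF mX] i by auto
  qed
  have evB: "Y i -` B \<inter> space M \<in> sigma_sets (space M) {?Y -` B \<inter> space M |B. B \<in> sets (PiM I N')}"
  proof (rule sigma_sets.Basic, intro CollectI exI conjI)
    show "(\<lambda>u. u i) -` B \<inter> space (PiM I N') \<in> sets (PiM I N')"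
      by (rule measurable_sets[OF measurable_component_singleton[OF i, of N'] B])
    show "Y i -` B \<inter> space M = ?Y -` ((\<lambda>u. u i) -` B \<inter> space (PiM I N')) \<inter> space M"
      using measurable_space[OF mY] i by auto
  qed
  have "(\<lambda>\<omega>. (X i \<omega>, Y i \<omega>)) -` (A \<times> B) \<inter> space M = (X i -` A \<inter> space M) \<inter> (Y i -` B \<inter> space M)" by auto
  then show "emeasure (distr M (M' i) (X i)) A * emeasure (distr M (N' i) (Y i)) B
      = emeasure (distr M (M' i \<Otimes>\<^sub>M N' i) (\<lambda>\<omega>. (X i \<omega>, Y i \<omega>))) (A \<times> B)"
    using A B indep_setD[OF ind evA evB]
    by (simp add: emeasure_distr emeasure_eq_measure ennreal_mult)
qed

section \<open>Integral equations and norms\<close>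

lemma integral_equation_unique_solution:
  fixes f :: "'a::euclidean_space \<Rightarrow> 'a"
  assumes T: "T \<ge> 0" and K: "K \<ge> 0" and lip: "\<And>x y. norm (f x - f y) \<le> K * norm (x - y)"
  shows "\<exists>!X. X \<in> cont_paths T \<and> (\<forall>t\<in>{0..T}. X t = \<xi> + (LINT r:{0..t}|lborel. f (X r)))"
proof -
  have f_cont: "continuous_on A f" for A
    by (intro lipschitz_on_continuous_on[of K] lipschitz_onI) (simp_all add: dist_norm lip K)
  \<comment> \<open>The equation is stated with the Lebesgue integral, while the estimates below use
    the gauge integral and its fundamental theorem. Along continuous paths the two agree.\<close>
  have to_HK: "(LINT r:{0..t}|lborel. f (X r)) = integral {0..t} (\<lambda>r. f (X r))"
    if "continuous_on {0..T} X" "t \<in> {0..T}" for X t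
  proof -
    have "continuous_on {0..t} X" using that by (auto intro: continuous_on_subset)
    then have "continuous_on {0..t} (\<lambda>r. f (X r))" by (rule continuous_on_compose2[OF f_cont[of UNIV]]) simp
    then show ?thesis by (intro set_borel_integral_eq_integral borel_integrable_atLeastAtMost')
  qed
  txt \<open>Rescaling by \<open>exp(-\<beta>t)\<close> makes the Picard operator a contraction of the bounded continuous functions.\<close>
  define \<beta> where "\<beta> = 2 * K + 1"
  have \<beta>: "\<beta> > 0" using K by (simp add: \<beta>_def)
  \<comment> \<open>Elements of \<open>bcontfun\<close> live on the whole line. The clamp extends a
    path constantly beyond {0..T}, and compactness of {0..T} then gives boundedness.\<close>
  define c where "c t = max 0 (min T t)" for t :: real
  have c: "c t \<in> {0..T}" "t \<in> {0..T} \<Longrightarrow> c t = t" for t using T by (auto simp: c_def)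
  have c_cont: "continuous_on UNIV c" unfolding c_def by (intro continuous_intros)
  define H where "H u t = exp (- \<beta> * t) *\<^sub>R (\<xi> + integral {0..t} (\<lambda>s. f (exp (\<beta> * s) *\<^sub>R u s)))"
    for u :: "real \<Rightarrow> 'a" and t
  have integrand_cont: "continuous_on A (\<lambda>s. f (exp (\<beta> * s) *\<^sub>R u s))" if "continuous_on A u" for u A
    by (rule continuous_on_compose2[OF f_cont[of UNIV]]) (auto intro!: continuous_intros that)
  have H_cont: "continuous_on {0..T} (H u)" if "continuous_on {0..T} u" for u
    unfolding H_def
    by (intro continuous_intros indefinite_integral_continuous_1 integrable_continuous_real integrand_cont that)
  have clamp_bcontfun: "(\<lambda>t. h (c t)) \<in> bcontfun" if h: "continuous_on {0..T} h" for h :: "real \<Rightarrow> 'a"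
  proof -
    have "bounded (h ` {0..T})"
      by (intro compact_imp_bounded compact_continuous_image h compact_Icc)
    then obtain b where "\<And>x. x \<in> h ` {0..T} \<Longrightarrow> norm x \<le> b" unfolding bounded_iff by blast
    then have "\<And>t. t \<in> {0..T} \<Longrightarrow> norm (h t) \<le> b" by simp
    moreover have "continuous_on UNIV (\<lambda>t. h (c t))"
      by (rule continuous_on_compose2[OF h c_cont]) (use c in auto)
    ultimately show ?thesis using c(1) by (intro bcontfun_normI) auto
  qed
  define \<Gamma> where "\<Gamma> u = Bcontfun (\<lambda>t. H (apply_bcontfun u) (c t))" for u
  have \<Gamma>: "apply_bcontfun (\<Gamma> u) t = H (apply_bcontfun u) (c t)" for u t
    unfolding \<Gamma>_def by (subst Bcontfun_inverse) (auto intro!: clamp_bcontfun H_cont)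
  have "\<exists>!u. \<Gamma> u = u"
  proof (rule banach_fix_type[of "1/2"])
    show "\<forall>u v. dist (\<Gamma> u) (\<Gamma> v) \<le> 1/2 * dist u v"
    proof (intro allI)
      fix u v :: "real \<Rightarrow>\<^sub>C 'a"
      let ?U = "\<lambda>s. f (exp (\<beta> * s) *\<^sub>R apply_bcontfun u s)" and ?V = "\<lambda>s. f (exp (\<beta> * s) *\<^sub>R apply_bcontfun v s)"
      show "dist (\<Gamma> u) (\<Gamma> v) \<le> 1/2 * dist u v"
      proof (rule dist_bound)
        fix t
        define x where "x = c t"
        have x: "x \<in> {0..T}" using c by (simp add: x_def)
        have Ui: "?U integrable_on {0..x}" and Vi: "?V integrable_on {0..x}"
          by (intro integrable_continuous_real integrand_cont continuous_on_apply_bcontfun)+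
        have E: "((\<lambda>s. K * dist u v * exp (\<beta> * s)) has_integral
            (K * dist u v * (exp (\<beta> * x) / \<beta>) - K * dist u v * (exp (\<beta> * 0) / \<beta>))) {0..x}"
          using x \<beta> by (intro fundamental_theorem_of_calculus)
            (auto intro!: derivative_eq_intros simp flip: has_real_derivative_iff_has_vector_derivative)
        have "norm (integral {0..x} (\<lambda>s. ?U s - ?V s)) \<le> integral {0..x} (\<lambda>s. K * dist u v * exp (\<beta> * s))"
        proof (rule integral_norm_bound_integral)
          show "(\<lambda>s. ?U s - ?V s) integrable_on {0..x}" using Ui Vi by (rule integrable_diff)
          show "(\<lambda>s. K * dist u v * exp (\<beta> * s)) integrable_on {0..x}" using E by blast
          fix s
          have "norm (?U s - ?V s) \<le> K * norm (exp (\<beta> * s) *\<^sub>R (apply_bcontfun u s - apply_bcontfun v s))"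
            unfolding scaleR_diff_right by (rule lip)
          also have "\<dots> = K * exp (\<beta> * s) * dist (apply_bcontfun u s) (apply_bcontfun v s)"
            by (simp add: dist_norm)
          also have "\<dots> \<le> K * exp (\<beta> * s) * dist u v"
            using K by (intro mult_left_mono dist_bounded) auto
          finally show "norm (?U s - ?V s) \<le> K * dist u v * exp (\<beta> * s)" by (simp add: mult_ac)
        qed
        also have "\<dots> = K * dist u v * ((exp (\<beta> * x) - 1) / \<beta>)"
          unfolding integral_unique[OF E] by (simp add: diff_divide_distrib right_diff_distrib)
        also have "\<dots> \<le> K * dist u v * (exp (\<beta> * x) / \<beta>)"
          using K \<beta> by (intro mult_left_mono divide_right_mono) auto
        finally have le: "norm (integral {0..x} (\<lambda>s. ?U s - ?V s)) \<le> K * dist u v * (exp (\<beta> * x) / \<beta>)" .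
        have "H (apply_bcontfun u) x - H (apply_bcontfun v) x = exp (- \<beta> * x) *\<^sub>R integral {0..x} (\<lambda>s. ?U s - ?V s)"
          unfolding H_def using Ui Vi by (simp add: integral_diff algebra_simps)
        then have "dist (apply_bcontfun (\<Gamma> u) t) (apply_bcontfun (\<Gamma> v) t)
            = exp (- \<beta> * x) * norm (integral {0..x} (\<lambda>s. ?U s - ?V s))"
          by (simp add: \<Gamma> dist_norm flip: x_def)
        also have "\<dots> \<le> exp (- \<beta> * x) * (K * dist u v * (exp (\<beta> * x) / \<beta>))"
          using le by (intro mult_left_mono) auto
        also have "\<dots> = (K / \<beta>) * dist u v" by (simp add: exp_minus field_simps)
        also have "\<dots> \<le> 1/2 * dist u v"
          using K \<beta> by (intro mult_right_mono) (auto simp: \<beta>_def field_simps)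
        finally show "dist (apply_bcontfun (\<Gamma> u) t) (apply_bcontfun (\<Gamma> v) t) \<le> 1/2 * dist u v" .
      qed
    qed
  qed auto
  then obtain u where u: "\<Gamma> u = u" and u_unique: "\<And>v. \<Gamma> v = v \<Longrightarrow> v = u" by auto
  define X where "X = (\<lambda>t\<in>{0..T}. exp (\<beta> * t) *\<^sub>R apply_bcontfun u t)"
  have X_path: "X \<in> cont_paths T"
  proof -
    have "continuous_on {0..T} X \<longleftrightarrow> continuous_on {0..T} (\<lambda>t. exp (\<beta> * t) *\<^sub>R apply_bcontfun u t)"
      by (rule continuous_on_cong) (auto simp: X_def)
    also have "\<dots>" by (intro continuous_intros continuous_on_apply_bcontfun)
    finally show ?thesis by (simp add: cont_paths_def X_def)
  qed
  show ?thesis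
  proof (rule ex1I[of _ X], intro conjI ballI)
    show "X \<in> cont_paths T" by (rule X_path)
    fix t assume t: "t \<in> {0..T}"
    have "apply_bcontfun u t = H (apply_bcontfun u) t" using \<Gamma>[of u t] u c(2)[OF t] by simp
    then have "X t = \<xi> + integral {0..t} (\<lambda>s. f (exp (\<beta> * s) *\<^sub>R apply_bcontfun u s))"
      using t by (simp add: X_def H_def exp_minus)
    also have "integral {0..t} (\<lambda>s. f (exp (\<beta> * s) *\<^sub>R apply_bcontfun u s)) = integral {0..t} (\<lambda>s. f (X s))"
      using t by (intro integral_cong) (simp add: X_def)
    finally show "X t = \<xi> + (LINT r:{0..t}|lborel. f (X r))"
      using X_path t by (simp add: to_HK cont_paths_def)
  next
    \<comment> \<open>Rescaled and clamped, any other solution is again a fixed point of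
      \<open>\<Gamma>\<close>, so uniqueness also comes from the contraction.\<close>
    fix Y assume Y: "Y \<in> cont_paths T \<and> (\<forall>t\<in>{0..T}. Y t = \<xi> + (LINT r:{0..t}|lborel. f (Y r)))"
    then have Y_cont: "continuous_on {0..T} Y" by (simp add: cont_paths_def)
    define h where "h t = exp (- \<beta> * t) *\<^sub>R Y t" for t
    have h: "continuous_on {0..T} h" unfolding h_def by (intro continuous_intros Y_cont)
    define v where "v = Bcontfun (\<lambda>t. h (c t))"
    have v: "apply_bcontfun v t = h (c t)" for t
      unfolding v_def by (subst Bcontfun_inverse) (auto intro!: clamp_bcontfun h)
    have "\<Gamma> v = v"
    proof (rule bcontfun_eqI)
      fix t
      have "H (apply_bcontfun v) (c t) = exp (- \<beta> * c t) *\<^sub>R (\<xi> + integral {0..c t} (\<lambda>s. f (Y s)))"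
      proof -
        have "integral {0..c t} (\<lambda>s. f (exp (\<beta> * s) *\<^sub>R apply_bcontfun v s)) = integral {0..c t} (\<lambda>s. f (Y s))"
        proof (rule integral_cong)
          fix s assume "s \<in> {0..c t}"
          then have "c s = s" using c(1)[of t] by (intro c(2)) auto
          then show "f (exp (\<beta> * s) *\<^sub>R apply_bcontfun v s) = f (Y s)"
            by (simp add: v h_def exp_minus)
        qed
        then show ?thesis by (simp add: H_def)
      qed
      also have "\<dots> = h (c t)"
        using Y c(1)[of t] to_HK[OF Y_cont c(1)[of t]] by (simp add: h_def)
      finally show "apply_bcontfun (\<Gamma> v) t = apply_bcontfun v t" by (simp add: \<Gamma> v)
    qed
    then have "v = u" by (rule u_unique)
    show "Y = X"
    proof (rule extensionalityI)
      show "Y \<in> extensional {0..T}" "X \<in> extensional {0..T}" using Y X_path by (auto simp: cont_paths_def)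
      fix t assume t: "t \<in> {0..T}"
      then have "apply_bcontfun u t = h t" using v[of t] c(2)[OF t] \<open>v = u\<close> by simp
      then show "Y t = X t" using t by (simp add: X_def h_def exp_minus)
    qed
  qed
qed

section \<open>Equivalence of norms in finite dimension\<close>

text \<open>The upper bound expands a vector in the basis. It makes \<open>nrm\<close> Lipschitz,
  hence continuous, so \<open>nrm\<close> attains a minimum on the compact Euclidean unit sphere;
  that minimum is positive and gives the lower bound by scaling.\<close>

lemma is_norm_equivalent:
  fixes nrm :: "'a::euclidean_space \<Rightarrow> real"
  assumes "is_norm nrm"
  obtains a b where "a > 0" "b > 0" "\<And>x. nrm x \<le> b * norm x" "\<And>x. norm x \<le> a * nrm x" "continuous_on UNIV nrm"
proof -
  have nonneg: "0 \<le> nrm x" and zero: "nrm x = 0 \<longleftrightarrow> x = 0" and scale: "nrm (r *\<^sub>R x) = \<bar>r\<bar> * nrm x"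
    and tri: "nrm (x + y) \<le> nrm x + nrm y" for x y r
    using assms by (auto simp: is_norm_def)
  have sum_le: "nrm (\<Sum>i\<in>I. g i) \<le> (\<Sum>i\<in>I. nrm (g i))" if "finite I" for I and g :: "'a \<Rightarrow> 'a"
    using that by (induction I) (auto simp: zero[THEN iffD2] intro: order_trans[OF tri])
  define b where "b = 1 + (\<Sum>i\<in>Basis. nrm i)"
  have b: "b > 0" unfolding b_def using nonneg by (intro add_pos_nonneg sum_nonneg) auto
  have le_b: "nrm x \<le> b * norm x" for x
  proof -
    have "nrm x = nrm (\<Sum>i\<in>Basis. (x \<bullet> i) *\<^sub>R i)" by (simp add: euclidean_representation)
    also have "\<dots> \<le> (\<Sum>i\<in>Basis. nrm ((x \<bullet> i) *\<^sub>R i))" by (rule sum_le) simp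
    also have "\<dots> \<le> (\<Sum>i\<in>Basis. norm x * nrm i)"
      unfolding scale by (intro sum_mono mult_right_mono nonneg Basis_le_norm)
    also have "\<dots> \<le> b * norm x" by (simp add: b_def algebra_simps sum_distrib_left)
    finally show ?thesis .
  qed
  have diff: "\<bar>nrm x - nrm y\<bar> \<le> nrm (x - y)" for x y
    using tri[of "x - y" y] tri[of "y - x" x] scale[of "-1" "x - y"] by simp
  have cont: "continuous_on A nrm" for A
    by (intro lipschitz_on_continuous_on[of b] lipschitz_onI)
      (use b in \<open>auto simp: dist_norm intro: order_trans[OF diff le_b]\<close>)
  have "sphere (0::'a) 1 \<noteq> {}" by simp
  then obtain z where z: "z \<in> sphere 0 1" "\<And>x. x \<in> sphere 0 1 \<Longrightarrow> nrm z \<le> nrm x"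
    using continuous_attains_inf[OF compact_sphere _ cont] by metis
  have "z \<noteq> 0" using z(1) by auto
  then have z0: "nrm z > 0" using nonneg[of z] zero[of z] by linarith
  have "norm x \<le> (1 / nrm z) * nrm x" for x
  proof (cases "x = 0")
    case False
    then have "nrm z \<le> nrm ((1 / norm x) *\<^sub>R x)" by (intro z) simp
    also have "\<dots> = nrm x / norm x" by (simp add: scale)
    finally show ?thesis using z0 False by (simp add: field_simps)
  qed (simp add: zero[THEN iffD2])
  then show ?thesis using that[of "1 / nrm z" b] z0 b le_b cont by simp
qed

section \<open>Complexity\<close>

text \<open>The logarithm of the product is \<open>(1 - p) * x * ln x\<close> up to terms of order
  x, so any \<open>p > 1\<close> beats every exponential factor. It is used with
  \<open>p = (2 + \<delta>) / 2\<close>, the only place where positivity of \<delta> is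
  decisive.\<close>

lemma power_self_cost_limit:
  fixes a p d g :: real
  assumes "a > 0" "p > 1"
  shows "((\<lambda>x::real. (x + a) * exp ((x + a) * ln (4 * (x + a))) * exp (p * (d + x * g - x * ln x))) \<longlongrightarrow> 0) at_top"
proof -
  have "1 - p < 0" using assms by simp
  have "filterlim (\<lambda>x::real. ln (x + a) + (x + a) * ln (4 * (x + a)) + p * (d + x * g - x * ln x)) at_bot at_top"
    using assms \<open>1 - p < 0\<close> by real_asymp
  then have "((\<lambda>x::real. exp (ln (x + a) + (x + a) * ln (4 * (x + a)) + p * (d + x * g - x * ln x))) \<longlongrightarrow> 0) at_top"
    by (rule filterlim_compose[OF exp_at_bot])
  moreover have "eventually (\<lambda>x::real. exp (ln (x + a) + (x + a) * ln (4 * (x + a)) + p * (d + x * g - x * ln x))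
      = (x + a) * exp ((x + a) * ln (4 * (x + a))) * exp (p * (d + x * g - x * ln x))) at_top"
    using eventually_gt_at_top[of 0] by eventually_elim (use assms in \<open>simp add: exp_add\<close>)
  ultimately show ?thesis by (rule Lim_transform_eventually)
qed

text \<open>Inductively, each of the three terms 1, \<open>RV l\<close>, \<open>RV (l - 1)\<close>
  is at most \<open>(4 * m) ^ l\<close>. The resulting factor 3 is exactly 4 - 1, so the sum over
  \<open>l\<close> is geometric and closes at base 4.\<close>

lemma evaluation_count_bound:
  fixes RV :: "nat \<Rightarrow> nat"
  assumes m: "m \<ge> 1" and RV_0: "RV 0 = 0"
    and RV_rec: "\<And>n. n \<ge> 1 \<Longrightarrow> RV n \<le> m ^ n + (\<Sum>l=1..n-1. m ^ (n - l) * (1 + RV l + RV (l - 1)))"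
  shows "RV n \<le> (4 * m) ^ n"
proof (induction n rule: less_induct)
  case (less n)
  show ?case
  proof (cases "n = 0")
    case False
    have step: "m ^ (n - l) * (1 + RV l + RV (l - 1)) \<le> m ^ n * (3 * 4 ^ l)" if l: "l \<in> {1..n-1}" for l
    proof -
      have le1: "RV l \<le> (4 * m) ^ l" using l False by (intro less) auto
      have "RV (l - 1) \<le> (4 * m) ^ (l - 1)" using l False by (intro less) auto
      also have "\<dots> \<le> (4 * m) ^ l" using m by (intro power_increasing) auto
      finally have le2: "RV (l - 1) \<le> (4 * m) ^ l" .
      have "1 \<le> (4 * m) ^ l" using m by simp
      then have "1 + RV l + RV (l - 1) \<le> 3 * (4 * m) ^ l" using le1 le2 by linarith
      then have "m ^ (n - l) * (1 + RV l + RV (l - 1)) \<le> m ^ (n - l) * (3 * (4 * m) ^ l)"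
        by (intro mult_left_mono) auto
      also have "\<dots> = (m ^ (n - l) * m ^ l) * (3 * 4 ^ l)" by (simp add: power_mult_distrib)
      also have "m ^ (n - l) * m ^ l = m ^ n"
        unfolding power_add[symmetric] using l by (intro arg_cong[where f="\<lambda>j. m ^ j"]) auto
      finally show ?thesis .
    qed
    have geo: "1 + (\<Sum>l=1..k. 3 * 4 ^ l) \<le> (4::nat) ^ Suc k" for k
      by (induction k) auto
    have "RV n \<le> m ^ n + (\<Sum>l=1..n-1. m ^ (n - l) * (1 + RV l + RV (l - 1)))"
      using False by (intro RV_rec) simp
    also have "\<dots> \<le> m ^ n + (\<Sum>l=1..n-1. m ^ n * (3 * 4 ^ l))"
      by (intro add_left_mono sum_mono step)
    also have "\<dots> = m ^ n * (1 + (\<Sum>l=1..n-1. 3 * 4 ^ l))"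
      by (simp add: sum_distrib_left)
    also have "\<dots> \<le> m ^ n * 4 ^ n"
      using geo[of "n - 1"] False by (intro mult_left_mono) auto
    finally show ?thesis by (simp add: power_mult_distrib mult.commute)
  qed (simp add: RV_0)
qed

text \<open>With n = N - 1 the minimality of N gives \<open>\<epsilon>\<^sup>2 < v n\<close>, so
  multiplying the cost by \<open>\<epsilon> powr (2 + \<delta>)\<close> costs at most the factor
  \<open>v n powr ((2 + \<delta>) / 2)\<close>. The product tends to 0 in n and is therefore bounded
  by a constant depending only on \<delta>.\<close>

lemma complexity_of_superexponential_error:
  fixes D G :: real and cost :: "nat \<Rightarrow> nat"
  assumes D: "D > 0" and G: "G > 0" and cost: "\<And>n. n \<ge> 1 \<Longrightarrow> cost n \<le> (4 * n) ^ n"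
  defines "v \<equiv> \<lambda>n::nat. D * G ^ n / real n ^ n"
  shows "\<exists>(c :: real \<Rightarrow> real) (N :: real \<Rightarrow> nat).
     (\<forall>\<delta>>0. c \<delta> \<ge> 0) \<and> (\<forall>\<epsilon>\<in>{0<..1}. N \<epsilon> \<ge> 1) \<and>
     (\<forall>\<delta>>0. \<forall>\<epsilon>\<in>{0<..1}. real (\<Sum>n=1..N \<epsilon> + k. cost n) \<le> c \<delta> * \<epsilon> powr (- (2 + \<delta>)) \<and>
        (\<forall>n\<ge>N \<epsilon>. v n \<le> \<epsilon>\<^sup>2))"
proof -
  have v_exp: "v n = exp (ln D + real n * ln G - real n * ln (real n))" if "n \<ge> 1" for n
    using that D G unfolding v_def
    by (simp add: exp_add exp_diff exp_of_nat_mult)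
  define a where "a = real k + 1"
  have a: "a > 0" by (simp add: a_def)
  \<comment> \<open>For n = N - 1 the number \<open>real n + a\<close> is N + k, the last index in
    the cost sum. The first two factors bound that sum by its number of terms times the largest
    bound; for n at least 1 the last factor is \<open>v n powr ((2 + \<delta>) / 2)\<close>.\<close>
  define s where "s \<delta> n = (real n + a) * exp ((real n + a) * ln (4 * (real n + a)))
      * exp ((2 + \<delta>) / 2 * (ln D + real n * ln G - real n * ln (real n)))" for \<delta> n
  have s_lim: "s \<delta> \<longlonglongrightarrow> 0" if "\<delta> > 0" for \<delta>
    unfolding s_def
    by (rule filterlim_compose[OF power_self_cost_limit[OF a, of "(2 + \<delta>) / 2"] filterlim_real_sequentially])
      (use that in simp)
  have v_lim: "v \<longlonglongrightarrow> 0"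
  proof -
    have "((\<lambda>x::real. exp (ln D + x * ln G - x * ln x)) \<longlongrightarrow> 0) at_top" by real_asymp
    then have "(\<lambda>n. exp (ln D + real n * ln G - real n * ln (real n))) \<longlonglongrightarrow> 0"
      by (rule filterlim_compose[OF _ filterlim_real_sequentially])
    then show ?thesis
      by (rule Lim_transform_eventually)
        (use eventually_ge_at_top[of 1] in \<open>eventually_elim, simp add: v_exp\<close>)
  qed
  have total: "real (\<Sum>n=1..M + k. cost n) \<le> real (M + k) * (4 * real (M + k)) ^ (M + k)" if "M \<ge> 1" for M
  proof -
    have "(\<Sum>n=1..M + k. cost n) \<le> (\<Sum>n=1..M + k. (4 * (M + k)) ^ (M + k))"
    proof (rule sum_mono)
      fix n assume n: "n \<in> {1..M + k}"
      have "cost n \<le> (4 * n) ^ n" using n by (intro cost) simp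
      also have "\<dots> \<le> (4 * (M + k)) ^ n" using n by (intro power_mono) auto
      also have "\<dots> \<le> (4 * (M + k)) ^ (M + k)" using n that by (intro power_increasing) auto
      finally show "cost n \<le> (4 * (M + k)) ^ (M + k)" .
    qed
    then have "real (\<Sum>n=1..M + k. cost n) \<le> real ((M + k) * (4 * (M + k)) ^ (M + k))"
      by (intro of_nat_mono) simp
    then show ?thesis by simp
  qed
  have "\<exists>C\<ge>0. \<forall>n. s \<delta> n \<le> C" if "\<delta> > 0" for \<delta>
  proof -
    have "Bseq (s \<delta>)" using s_lim[OF that] by (intro convergent_imp_Bseq convergentI)
    then obtain C where "\<And>n. norm (s \<delta> n) \<le> C" "C > 0" unfolding Bseq_def by blast
    then show ?thesis by (intro exI[of _ C]) (auto dest: abs_le_D1)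
  qed
  then have "\<exists>C. \<forall>\<delta>>0. C \<delta> \<ge> 0 \<and> (\<forall>n. s \<delta> n \<le> C \<delta>)" by metis
  then obtain C where C: "\<And>\<delta>. \<delta> > 0 \<Longrightarrow> C \<delta> \<ge> 0" "\<And>\<delta> n. \<delta> > 0 \<Longrightarrow> s \<delta> n \<le> C \<delta>" by blast
  \<comment> \<open>The bound on the total cost when N = 1. Then N - 1 = 0 is excluded from
    \<open>Good\<close> by definition, and minimality says nothing about the error there.\<close>
  define K1 where "K1 = real (1 + k) * (4 * real (1 + k)) ^ (1 + k)"
  have K1: "K1 \<ge> 0" unfolding K1_def by (intro mult_nonneg_nonneg) auto
  \<comment> \<open>The threshold has to work for all later indices: \<open>v\<close> may grow
    before it decays, so a first index with small error would not do.\<close>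
  define Good where "Good \<epsilon> N \<longleftrightarrow> N \<ge> 1 \<and> (\<forall>n\<ge>N. v n \<le> \<epsilon>\<^sup>2)" for \<epsilon> N
  define N where "N \<epsilon> = (LEAST N. Good \<epsilon> N)" for \<epsilon>
  have N_good: "Good \<epsilon> (N \<epsilon>)" if "\<epsilon> \<in> {0<..1}" for \<epsilon>
  proof -
    have "eventually (\<lambda>n. v n < \<epsilon>\<^sup>2) sequentially"
      using v_lim that by (intro order_tendstoD) auto
    then obtain M where "\<And>n. n \<ge> M \<Longrightarrow> v n < \<epsilon>\<^sup>2" by (auto simp: eventually_sequentially)
    then have "Good \<epsilon> (max 1 M)" by (auto simp: Good_def less_imp_le)
    then show ?thesis unfolding N_def by (rule LeastI)
  qed
  have bound: "real (\<Sum>n=1..N \<epsilon> + k. cost n) \<le> (C \<delta> + K1) * \<epsilon> powr (- (2 + \<delta>))"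
    if \<delta>: "\<delta> > 0" and \<epsilon>: "\<epsilon> \<in> {0<..1}" for \<delta> \<epsilon>
  proof (cases "N \<epsilon> = 1")
    case True
    have "\<epsilon> powr (2 + \<delta>) \<le> 1 powr (2 + \<delta>)" using \<epsilon> \<delta> by (intro powr_mono2) auto
    then have "1 \<le> \<epsilon> powr (- (2 + \<delta>))" unfolding powr_minus using \<epsilon> by (intro one_le_inverse) auto
    have "real (\<Sum>n=1..N \<epsilon> + k. cost n) \<le> K1" using total[of 1] unfolding True K1_def by simp
    also have "\<dots> \<le> (C \<delta> + K1) * 1" using C(1)[OF \<delta>] by simp
    also have "\<dots> \<le> (C \<delta> + K1) * \<epsilon> powr (- (2 + \<delta>))"
      using C(1)[OF \<delta>] \<open>1 \<le> \<epsilon> powr _\<close> by (intro mult_left_mono) (auto simp: K1_def)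
    finally show ?thesis .
  next
    case False
    define n where "n = N \<epsilon> - 1"
    have n: "n \<ge> 1" "N \<epsilon> = n + 1" using N_good[OF \<epsilon>] False by (auto simp: n_def Good_def)
    \<comment> \<open>Failure at \<open>n\<close> only yields some later index with a large error;
      as \<open>n + 1\<close> is good, that index is \<open>n\<close> itself.\<close>
    have "\<not> Good \<epsilon> n" using n unfolding N_def by (intro not_less_Least) simp
    then obtain j where j: "j \<ge> n" "v j > \<epsilon>\<^sup>2" using n by (auto simp: Good_def not_le)
    have "\<not> j \<ge> n + 1" using j N_good[OF \<epsilon>] n by (auto simp: Good_def not_le[symmetric])
    then have "j = n" using j by simp
    then have vn: "\<epsilon>\<^sup>2 < v n" using j by simp
    have "\<epsilon> powr (2 + \<delta>) = (\<epsilon>\<^sup>2) powr ((2 + \<delta>) / 2)"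
      using \<epsilon> by (simp add: powr_powr add_divide_distrib flip: powr_numeral)
    also have "\<dots> \<le> v n powr ((2 + \<delta>) / 2)" using vn \<delta> by (intro powr_mono2) auto
    also have "\<dots> = exp ((2 + \<delta>) / 2 * (ln D + real n * ln G - real n * ln (real n)))"
      using n by (simp add: v_exp powr_def)
    finally have e: "\<epsilon> powr (2 + \<delta>) \<le> exp ((2 + \<delta>) / 2 * (ln D + real n * ln G - real n * ln (real n)))" .
    have na: "real n + a = real (N \<epsilon> + k)" using n by (simp add: a_def)
    have "exp ((real n + a) * ln (4 * (real n + a))) = (4 * real (N \<epsilon> + k)) ^ (N \<epsilon> + k)"
      unfolding na using n by (subst exp_of_nat_mult) simp
    then have "real (\<Sum>n=1..N \<epsilon> + k. cost n) \<le> (real n + a) * exp ((real n + a) * ln (4 * (real n + a)))"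
      using total[of "N \<epsilon>"] n by (simp add: a_def algebra_simps)
    then have "real (\<Sum>n=1..N \<epsilon> + k. cost n) * \<epsilon> powr (2 + \<delta>) \<le> s \<delta> n"
      unfolding s_def using e a by (intro mult_mono) auto
    also have "\<dots> \<le> C \<delta> + K1" using C(2)[OF \<delta>, of n] K1 by linarith
    finally have "real (\<Sum>n=1..N \<epsilon> + k. cost n) * \<epsilon> powr (2 + \<delta>) \<le> C \<delta> + K1" .
    moreover have "\<epsilon> powr (2 + \<delta>) > 0" using \<epsilon> by simp
    ultimately show ?thesis unfolding powr_minus by (simp only: pos_le_divide_eq flip: divide_inverse)
  qed
  show ?thesis
  proof (intro exI conjI allI ballI impI)
    show "0 \<le> C \<delta> + K1" if "\<delta> > 0" for \<delta> using C(1)[OF that] by (simp add: K1_def)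
    show "1 \<le> N \<epsilon>" if "\<epsilon> \<in> {0<..1}" for \<epsilon> using N_good[OF that] by (simp add: Good_def)
    show "v n \<le> \<epsilon>\<^sup>2" if "\<epsilon> \<in> {0<..1}" "N \<epsilon> \<le> n" for \<epsilon> n using N_good[OF that(1)] that(2) by (simp add: Good_def)
  qed (rule bound)
qed

section \<open>The multilevel Picard recursion\<close>

text \<open>Re-rooting at \<zeta>. Since the empty list is not in \<open>Theta\<close>, the label at
  \<zeta> itself is left out, which later makes it independent of the subtree. The restriction to
  \<open>Theta\<close> keeps the result in the product space.\<close>

definition subtree :: "int list \<Rightarrow> (int list \<Rightarrow> 'b) \<Rightarrow> int list \<Rightarrow> 'b" where
  "subtree \<zeta> w = (\<lambda>\<eta>\<in>Theta. w (\<zeta> @ \<eta>))"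

lemma Theta_iff: "\<theta> \<in> Theta \<longleftrightarrow> \<theta> \<noteq> []"
  by (cases \<theta>) (auto simp: Theta_def)

lemma subtree_subtree: "subtree \<zeta> (subtree \<theta> w) = subtree (\<theta> @ \<zeta>) w"
  by (auto simp: subtree_def Theta_iff fun_eq_iff restrict_def)

text \<open>
  The scheme as a deterministic function of a tree \<open>w\<close> of pairs (uniform variable, realization of \<open>Z\<close>).
  The term of the recursion containing \<open>F(\<xi>, \<cdot>)\<close> is the summand \<open>l = 0\<close>.
\<close>

fun mlp :: "('a::euclidean_space \<times> 's \<Rightarrow> 'a) \<Rightarrow> 'a \<Rightarrow> nat \<Rightarrow> nat \<Rightarrow> real \<Rightarrow> (int list \<Rightarrow> real \<times> 's) \<Rightarrow> 'a" where
  "mlp F \<xi> m n t w = \<xi> + (\<Sum>l<n. (t / real m ^ (n - l)) *\<^sub>R (\<Sum>k=1..m ^ (n - l).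
     F (mlp F \<xi> m l (fst (w [int l, int k]) * t) (subtree [int l, int k] w), snd (w [int l, int k]))
     - (if l = 0 then 0 else
         F (mlp F \<xi> m (l - 1) (fst (w [int l, int k]) * t) (subtree [int l, - int k] w), snd (w [int l, int k])))))"

declare mlp.simps [simp del]

lemma mlp_0 [simp]: "mlp F \<xi> m 0 t w = \<xi>"
  by (subst mlp.simps) simp

text \<open>Settles time 0 separately, since the averaged error bounds carry a factor 1/t.\<close>

lemma mlp_time_0: "mlp F \<xi> m n 0 w = \<xi>"
  by (subst mlp.simps) simp

lemma measurable_subtree [measurable]: "subtree \<zeta> \<in> PiM Theta (\<lambda>_. M) \<rightarrow>\<^sub>M PiM Theta (\<lambda>_. M)"
  unfolding subtree_def by (intro measurable_restrict measurable_component_singleton) (auto simp: Theta_iff)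

text \<open>Measurability is needed jointly in time and tree, because the recursion evaluates lower
  levels at times read off from the tree.\<close>

lemma measurable_mlp:
  assumes F: "F \<in> borel \<Otimes>\<^sub>M S \<rightarrow>\<^sub>M borel"
  shows "(\<lambda>p. mlp F \<xi> m n (fst p) (snd p)) \<in> borel \<Otimes>\<^sub>M PiM Theta (\<lambda>_. borel \<Otimes>\<^sub>M S) \<rightarrow>\<^sub>M borel"
proof (induction n rule: less_induct)
  case (less n)
  let ?N = "PiM Theta (\<lambda>_. (borel :: real measure) \<Otimes>\<^sub>M S)"
  let ?M = "(borel :: real measure) \<Otimes>\<^sub>M ?N"
  have comp: "(\<lambda>p. snd p \<zeta>) \<in> ?M \<rightarrow>\<^sub>M (borel :: real measure) \<Otimes>\<^sub>M S"
    if "\<zeta> \<in> Theta" for \<zeta>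
    using that by measurable
  have step: "(\<lambda>p. F (mlp F \<xi> m l (fst (snd p \<zeta>) * fst p) (subtree \<zeta>' (snd p)), snd (snd p \<zeta>)))
      \<in> ?M \<rightarrow>\<^sub>M borel" if "l < n" "\<zeta> \<in> Theta" for l \<zeta> \<zeta>'
  proof -
    have "(\<lambda>p. (fst (snd p \<zeta>) * fst p, subtree \<zeta>' (snd p)))
        \<in> ?M \<rightarrow>\<^sub>M ?M"
    proof (rule measurable_Pair)
      have "(\<lambda>p. fst (snd p \<zeta>)) \<in> ?M \<rightarrow>\<^sub>M borel"
        by (rule measurable_compose[OF comp[OF that(2)] measurable_fst])
      then show "(\<lambda>p. fst (snd p \<zeta>) * fst p) \<in> ?M \<rightarrow>\<^sub>M borel"
        by (intro borel_measurable_times measurable_fst)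
      show "(\<lambda>p. subtree \<zeta>' (snd p)) \<in> ?M \<rightarrow>\<^sub>M ?N"
        by (rule measurable_compose[OF measurable_snd measurable_subtree])
    qed
    from measurable_compose[OF this less[OF that(1)]]
    have "(\<lambda>p. mlp F \<xi> m l (fst (snd p \<zeta>) * fst p) (subtree \<zeta>' (snd p)))
        \<in> ?M \<rightarrow>\<^sub>M borel" by simp
    then show ?thesis
      by (intro measurable_compose[OF _ F] measurable_Pair measurable_compose[OF comp[OF that(2)] measurable_snd])
  qed
  define G where "G l k p = F (mlp F \<xi> m l (fst (snd p [int l, int k]) * fst p) (subtree [int l, int k] (snd p)), snd (snd p [int l, int k]))
     - (if l = 0 then 0 else
         F (mlp F \<xi> m (l - 1) (fst (snd p [int l, int k]) * fst p) (subtree [int l, - int k] (snd p)), snd (snd p [int l, int k])))"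
    for l k p
  have G: "G l k \<in> ?M \<rightarrow>\<^sub>M borel" if "l < n" for l k
    unfolding G_def
  proof (rule borel_measurable_diff)
    have node: "[int l, int k] \<in> Theta" by (simp add: Theta_iff)
    show "(\<lambda>p. F (mlp F \<xi> m l (fst (snd p [int l, int k]) * fst p) (subtree [int l, int k] (snd p)), snd (snd p [int l, int k])))
       \<in> ?M \<rightarrow>\<^sub>M borel"
      using that node by (rule step)
    show "(\<lambda>p. if l = 0 then 0 else
         F (mlp F \<xi> m (l - 1) (fst (snd p [int l, int k]) * fst p) (subtree [int l, - int k] (snd p)), snd (snd p [int l, int k])))
       \<in> ?M \<rightarrow>\<^sub>M borel"
    proof (cases "l = 0")
      case False
      have "l - 1 < n" using that by simp
      from step[OF this node] False show ?thesis by (simp only: if_False)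
    qed simp
  qed
  have "(\<lambda>p. mlp F \<xi> m n (fst p) (snd p))
      = (\<lambda>p. \<xi> + (\<Sum>l<n. (fst p / real m ^ (n - l)) *\<^sub>R (\<Sum>k=1..m ^ (n - l). G l k p)))"
    unfolding G_def by (rule ext) (rule mlp.simps)
  moreover have "\<dots> \<in> ?M \<rightarrow>\<^sub>M borel"
    by (intro borel_measurable_add borel_measurable_const borel_measurable_sum borel_measurable_scaleR
        borel_measurable_divide measurable_fst G) simp
  ultimately show ?case by simp
qed

section \<open>Uniform random times and square integrability\<close>

lemma uniform_01_eq_density: "uniform_measure lborel {0..1::real} = density lborel (indicator {0..1})"
  unfolding uniform_measure_def by (intro arg_cong[where f="density lborel"] ext) (simp add: divide_ennreal_def)

lemma prob_space_uniform_01: "prob_space (uniform_measure lborel {0..1::real})"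
  by (rule prob_space_uniform_measure) auto

text \<open>Used with \<open>c = m * t\<close>: this is the source of the factor 1/m gained at each
  level.\<close>

lemma nn_integral_uniform_exp:
  fixes c :: real
  assumes c: "c > 0"
  shows "(\<integral>\<^sup>+r. ennreal (exp (c * r)) \<partial>uniform_measure lborel {0..1}) \<le> ennreal (exp c / c)"
proof -
  have "(\<integral>\<^sup>+r. ennreal (exp (c * r)) \<partial>uniform_measure lborel {0..1})
      = (\<integral>\<^sup>+r. ennreal (exp (c * r)) * indicator {0..1} r \<partial>lborel)"
    unfolding uniform_01_eq_density by (subst nn_integral_density) (auto simp: mult.commute)
  also have "\<dots> = ennreal (exp (c * 1) / c - exp (c * 0) / c)"
    using c by (intro nn_integral_FTC_Icc[where F="\<lambda>r. exp (c * r) / c"])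
      (auto intro!: derivative_eq_intros)
  also have "\<dots> \<le> ennreal (exp c / c)" using c by (intro ennreal_leI) auto
  finally show ?thesis .
qed

text \<open>The substitution s = r t. It turns an expectation at a uniform random time into the time
  integral of the integral equation.\<close>

lemma integral_uniform_scale:
  fixes g :: "real \<Rightarrow> 'a::euclidean_space"
  assumes t: "t > 0" and [measurable]: "g \<in> borel_measurable borel"
  shows "t *\<^sub>R (LINT r|uniform_measure lborel {0..1}. g (r * t)) = (LINT s:{0..t}|lborel. g s)"
proof -
  have "(LINT r|uniform_measure lborel {0..1}. g (r * t)) = (LINT r|lborel. indicator {0..1} r *\<^sub>R g (r * t))"
  proof -
    have "uniform_measure lborel {0..1::real} = density lborel (\<lambda>r. ennreal (indicator {0..1} r))"
      unfolding uniform_01_eq_density by (intro arg_cong[where f="density lborel"] ext) (simp add: ennreal_indicator)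
    then show ?thesis by (simp only:) (subst integral_density; simp)
  qed
  moreover have "(LINT s|lborel. indicator {0..t} s *\<^sub>R g s)
      = \<bar>t\<bar> *\<^sub>R (LINT r|lborel. indicator {0..t} (0 + t * r) *\<^sub>R g (0 + t * r))"
    using t by (intro lborel_integral_real_affine) simp
  moreover have "indicator {0..t} (0 + t * r) = (indicator {0..1} r :: real)" for r
    using t by (auto simp: indicator_def mult_le_cancel_left1 zero_le_mult_iff)
  ultimately show ?thesis using t by (simp add: set_lebesgue_integral_def mult.commute)
qed

lemma norm_add_sq_le:
  fixes x y :: "'a::real_normed_vector"
  shows "(norm (x + y))\<^sup>2 \<le> 2 * (norm x)\<^sup>2 + 2 * (norm y)\<^sup>2"
proof -
  have "(norm (x + y))\<^sup>2 \<le> (norm x + norm y)\<^sup>2" by (intro power_mono norm_triangle_ineq) simp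
  also have "\<dots> \<le> 2 * (norm x)\<^sup>2 + 2 * (norm y)\<^sup>2"
    using zero_le_power2[of "norm x - norm y"] by (simp add: power2_sum power2_diff del: zero_le_power2)
  finally show ?thesis .
qed

lemma (in prob_space) norm_expectation_sq_le:
  fixes X :: "'a \<Rightarrow> 'b::euclidean_space"
  assumes X: "integrable M X" and sq: "integrable M (\<lambda>\<omega>. (norm (X \<omega>))\<^sup>2)"
  shows "(norm (expectation X))\<^sup>2 \<le> expectation (\<lambda>\<omega>. (norm (X \<omega>))\<^sup>2)"
proof -
  have "norm (expectation X) \<le> expectation (\<lambda>\<omega>. norm (X \<omega>))" by (rule integral_norm_bound)
  then have "(norm (expectation X))\<^sup>2 \<le> (expectation (\<lambda>\<omega>. norm (X \<omega>)))\<^sup>2" by (intro power_mono) auto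
  also have "\<dots> \<le> expectation (\<lambda>\<omega>. (norm (X \<omega>))\<^sup>2)"
    using variance_positive[of "\<lambda>\<omega>. norm (X \<omega>)"] variance_eq[of "\<lambda>\<omega>. norm (X \<omega>)"] X sq by simp
  finally show ?thesis .
qed

text \<open>The passage from extended nonnegative integrals, where bounds need no integrability, to
  the Bochner expectations of the bias-variance estimate.\<close>

lemma (in prob_space) integrable_sq_of_nn_integral:
  fixes X :: "'a \<Rightarrow> 'b::euclidean_space"
  assumes [measurable]: "random_variable borel X"
    and le: "(\<integral>\<^sup>+\<omega>. ennreal ((norm (X \<omega>))\<^sup>2) \<partial>M) \<le> ennreal b" and b: "b \<ge> 0"
  shows "integrable M (\<lambda>\<omega>. (norm (X \<omega>))\<^sup>2)" "expectation (\<lambda>\<omega>. (norm (X \<omega>))\<^sup>2) \<le> b"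
proof -
  have fin: "(\<integral>\<^sup>+\<omega>. ennreal ((norm (X \<omega>))\<^sup>2) \<partial>M) < \<infinity>"
    using le_less_trans[OF le ennreal_less_top] by simp
  show i: "integrable M (\<lambda>\<omega>. (norm (X \<omega>))\<^sup>2)"
    by (rule integrableI_nonneg) (use fin in auto)
  have "ennreal (expectation (\<lambda>\<omega>. (norm (X \<omega>))\<^sup>2)) \<le> ennreal b"
    using le by (subst nn_integral_eq_integral[symmetric]) (use i in auto)
  then show "expectation (\<lambda>\<omega>. (norm (X \<omega>))\<^sup>2) \<le> b" using b by simp
qed

text \<open>Here \<open>K\<close>, \<open>e\<close>, \<open>x\<close> stand for
  \<open>L\<^sup>2 * T\<close>, \<open>exp (m * t)\<close> and \<open>T\<^sup>2 * C0\<close>. In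
  units of \<open>B * e / m ^ n\<close> the three contributions are at most 1, 4K times the sum of
  the \<open>\<kappa> ^ l\<close>, and \<open>K * \<kappa> ^ (n - 1)\<close>. With
  \<open>\<kappa> = 2 + 10 * K\<close> they are at most 1/2, 4/10 and 1/10 of
  \<open>\<kappa> ^ n\<close>, which add up to exactly the claimed bound.\<close>

lemma mlp_bound_recursion:
  fixes B K x e \<kappa> :: real and m n :: nat
  assumes m: "m \<ge> 1" and n: "n \<ge> 1" and K: "K \<ge> 0" and e: "e \<ge> 1" and x: "0 \<le> x" "x \<le> B"
    and \<kappa>: "\<kappa> = 2 + 10 * K"
  shows "x / real m ^ n
     + (\<Sum>l=1..n-1. (1 / real m ^ (n - l)) * (2 * (K * (e / m)) * (B * \<kappa> ^ l / real m ^ l + B * \<kappa> ^ (l - 1) / real m ^ (l - 1))))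
     + K * (e / m) * (B * \<kappa> ^ (n - 1) / real m ^ (n - 1)) \<le> B * \<kappa> ^ n / real m ^ n * e"
proof -
  have \<kappa>2: "\<kappa> \<ge> 2" using K \<kappa> by simp
  have B: "B \<ge> 0" using x by simp
  have m0: "real m > 0" using m by simp
  \<comment> \<open>Both terms in the last bracket are at most
    \<open>B * \<kappa> ^ l / m ^ (l - 1)\<close>, hence the 4; the 1/m in \<open>e / m\<close> then
    completes the denominator to \<open>m ^ n\<close>.\<close>
  have summand: "(1 / real m ^ (n - l)) * (2 * (K * (e / m)) * (B * \<kappa> ^ l / real m ^ l + B * \<kappa> ^ (l - 1) / real m ^ (l - 1)))
      \<le> 4 * K * e * B / real m ^ n * \<kappa> ^ l" if l: "l \<in> {1..n-1}" for l
  proof -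
    have l': "l \<ge> 1" "l < n" using l n by auto
    have p: "\<kappa> ^ (l - 1) \<le> \<kappa> ^ l" using \<kappa>2 by (intro power_increasing) auto
    have mn: "real m ^ n = real m ^ (n - l) * (m * real m ^ (l - 1))"
      using l' by (simp flip: power_add power_Suc)
    have ml: "real m ^ l = m * real m ^ (l - 1)" using l' by (simp flip: power_Suc)
    have "B * \<kappa> ^ l / real m ^ l \<le> B * \<kappa> ^ l / real m ^ (l - 1)"
      using m m0 B \<kappa>2 by (intro divide_left_mono power_increasing) auto
    moreover have "B * \<kappa> ^ (l - 1) / real m ^ (l - 1) \<le> B * \<kappa> ^ l / real m ^ (l - 1)"
      using p B by (intro divide_right_mono mult_left_mono) auto
    ultimately have "B * \<kappa> ^ l / real m ^ l + B * \<kappa> ^ (l - 1) / real m ^ (l - 1) \<le> 2 * (B * \<kappa> ^ l / real m ^ (l - 1))"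
      by linarith
    then have "(1 / real m ^ (n - l)) * (2 * (K * (e / m)) * (B * \<kappa> ^ l / real m ^ l + B * \<kappa> ^ (l - 1) / real m ^ (l - 1)))
      \<le> (1 / real m ^ (n - l)) * (2 * (K * (e / m)) * (2 * (B * \<kappa> ^ l / real m ^ (l - 1))))"
      using K e by (intro mult_left_mono) auto
    also have "\<dots> = 4 * K * e * B / real m ^ n * \<kappa> ^ l"
      unfolding mn using m0 by (simp add: field_simps)
    finally show ?thesis .
  qed
  have geo: "(\<kappa> - 1) * (\<Sum>l=1..k. \<kappa> ^ l) \<le> \<kappa> ^ Suc k" for k
    using \<kappa>2 by (induction k) (auto simp: algebra_simps)
  have geo': "(\<kappa> - 1) * (\<Sum>l=1..n-1. \<kappa> ^ l) \<le> \<kappa> ^ n" using geo[of "n - 1"] n by simp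
  have "10 * K * (\<Sum>l=1..n-1. \<kappa> ^ l) \<le> (\<kappa> - 1) * (\<Sum>l=1..n-1. \<kappa> ^ l)"
    using \<kappa> \<kappa>2 by (intro mult_right_mono sum_nonneg) auto
  with geo' have s1: "10 * K * (\<Sum>l=1..n-1. \<kappa> ^ l) \<le> \<kappa> ^ n" by simp
  have s2: "10 * K * \<kappa> ^ (n - 1) \<le> \<kappa> ^ n"
  proof -
    have "10 * K * \<kappa> ^ (n - 1) \<le> \<kappa> * \<kappa> ^ (n - 1)" using \<kappa> \<kappa>2 by (intro mult_right_mono) auto
    then show ?thesis using n by (simp flip: power_Suc)
  qed
  have s3: "2 \<le> \<kappa> ^ n"
  proof -
    have "\<kappa> ^ 1 \<le> \<kappa> ^ n" using n \<kappa>2 by (intro power_increasing) auto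
    then show ?thesis using \<kappa>2 by simp
  qed
  have "(\<Sum>l=1..n-1. (1 / real m ^ (n - l)) * (2 * (K * (e / m)) * (B * \<kappa> ^ l / real m ^ l + B * \<kappa> ^ (l - 1) / real m ^ (l - 1))))
     \<le> (\<Sum>l=1..n-1. 4 * K * e * B / real m ^ n * \<kappa> ^ l)" by (rule sum_mono) (rule summand)
  also have "\<dots> = (B * e / real m ^ n) * (4 * K * (\<Sum>l=1..n-1. \<kappa> ^ l))"
    by (simp add: sum_distrib_left mult_ac)
  finally have b1: "(\<Sum>l=1..n-1. (1 / real m ^ (n - l)) * (2 * (K * (e / m)) * (B * \<kappa> ^ l / real m ^ l + B * \<kappa> ^ (l - 1) / real m ^ (l - 1))))
     \<le> (B * e / real m ^ n) * (4 * K * (\<Sum>l=1..n-1. \<kappa> ^ l))" .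
  have mn: "real m ^ n = m * real m ^ (n - 1)" using n by (simp flip: power_Suc)
  have b2: "K * (e / m) * (B * \<kappa> ^ (n - 1) / real m ^ (n - 1)) = (B * e / real m ^ n) * (K * \<kappa> ^ (n - 1))"
    unfolding mn by simp
  have "x * 1 \<le> B * e" using x e B by (intro mult_mono) auto
  then have b3: "x / real m ^ n \<le> (B * e / real m ^ n) * 1"
    by (simp add: divide_right_mono)
  have "x / real m ^ n
     + (\<Sum>l=1..n-1. (1 / real m ^ (n - l)) * (2 * (K * (e / m)) * (B * \<kappa> ^ l / real m ^ l + B * \<kappa> ^ (l - 1) / real m ^ (l - 1))))
     + K * (e / m) * (B * \<kappa> ^ (n - 1) / real m ^ (n - 1))
     \<le> (B * e / real m ^ n) * 1 + (B * e / real m ^ n) * (4 * K * (\<Sum>l=1..n-1. \<kappa> ^ l)) + (B * e / real m ^ n) * (K * \<kappa> ^ (n - 1))"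
    unfolding b2 by (intro add_mono b1 b3 order_refl)
  also have "\<dots> = (B * e / real m ^ n) * (1 + 4 * K * (\<Sum>l=1..n-1. \<kappa> ^ l) + K * \<kappa> ^ (n - 1))"
    by (simp only: distrib_left)
  also have "\<dots> \<le> (B * e / real m ^ n) * \<kappa> ^ n"
    using s1 s2 s3 B e by (intro mult_left_mono) auto
  finally show ?thesis by (simp add: mult_ac)
qed

section \<open>Laws and independence of the tree data\<close>

text \<open>The problem in the Euclidean norm, with \<open>\<nu>\<close> the law of Z and
  \<open>W\<close> the labels (uniform variable, realization of Z). The exact solution
  \<open>Y\<close> is taken on the whole line, continuous and at bounded distance from \<xi>, so
  that expressions at time \<open>r * t\<close> are measurable and bounded for all real
  \<open>r\<close>.\<close>

locale mlp_setting = prob_space P for P :: "'w measure" +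
  fixes T L C :: real and \<xi> :: "'a::euclidean_space" and S \<nu> :: "'s measure"
    and F :: "'a \<times> 's \<Rightarrow> 'a" and W :: "int list \<Rightarrow> 'w \<Rightarrow> real \<times> 's" and Y :: "real \<Rightarrow> 'a"
  assumes T: "T \<ge> 0" and L: "L \<ge> 0"
    and F_meas [measurable]: "F \<in> borel \<Otimes>\<^sub>M S \<rightarrow>\<^sub>M borel"
    and F_lip: "\<And>x y s. s \<in> space S \<Longrightarrow> norm (F (x, s) - F (y, s)) \<le> L * norm (x - y)"
    and prob_nu: "prob_space \<nu>" and sets_nu [measurable_cong]: "sets \<nu> = sets S"
    and F_xi: "(\<integral>\<^sup>+s. ennreal ((norm (F (\<xi>, s)))\<^sup>2) \<partial>\<nu>) < \<infinity>"
    and W_indep: "indep_vars (\<lambda>_. borel \<Otimes>\<^sub>M S) W Theta"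
    and W_distr: "\<And>\<theta>. \<theta> \<in> Theta \<Longrightarrow> distr P (borel \<Otimes>\<^sub>M S) (W \<theta>) = uniform_measure lborel {0..1} \<Otimes>\<^sub>M \<nu>"
    and W_range: "\<And>\<theta> \<omega>. \<theta> \<in> Theta \<Longrightarrow> \<omega> \<in> space P \<Longrightarrow> fst (W \<theta> \<omega>) \<in> {0..1}"
    and Y_cont: "continuous_on UNIV Y" and Y_bound: "\<And>s. norm (Y s - \<xi>) \<le> C"
    and Y_eq: "\<And>t. t \<in> {0..T} \<Longrightarrow> Y t = \<xi> + (LINT r:{0..t}|lborel. (LINT s|\<nu>. F (Y r, s)))"
begin

abbreviation U :: "real measure" where "U \<equiv> uniform_measure lborel {0..1}"
abbreviation \<mu> :: "(real \<times> 's) measure" where "\<mu> \<equiv> U \<Otimes>\<^sub>M \<nu>"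
abbreviation Tree :: "(int list \<Rightarrow> real \<times> 's) measure" where "Tree \<equiv> PiM Theta (\<lambda>_. borel \<Otimes>\<^sub>M S)"
abbreviation Q :: "(int list \<Rightarrow> real \<times> 's) measure" where "Q \<equiv> PiM Theta (\<lambda>_. \<mu>)"
abbreviation \<Phi> :: "nat \<Rightarrow> nat \<Rightarrow> real \<Rightarrow> (int list \<Rightarrow> real \<times> 's) \<Rightarrow> 'a" where "\<Phi> \<equiv> mlp F \<xi>"

definition D :: "int list \<Rightarrow> 'w \<Rightarrow> int list \<Rightarrow> real \<times> 's" where
  "D \<theta> \<omega> = subtree \<theta> (\<lambda>\<eta>. W \<eta> \<omega>)"

definition C0 :: real where "C0 = (\<integral>s. (norm (F (\<xi>, s)))\<^sup>2 \<partial>\<nu>)"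

text \<open>Integrating over the canonical tree space \<open>Q\<close> instead of \<open>P\<close>
  builds the independence of \<theta> into the definition.\<close>

definition err :: "nat \<Rightarrow> nat \<Rightarrow> real \<Rightarrow> ennreal" where
  "err m n s = (\<integral>\<^sup>+w. ennreal ((norm (\<Phi> m n s w - Y s))\<^sup>2) \<partial>Q)"

lemma prob_U: "prob_space U" by (rule prob_space_uniform_01)

lemma prob_mu: "prob_space \<mu>"
  by (intro prob_space_pair prob_U prob_nu)

lemma prob_Q: "prob_space Q"
  by (intro prob_space_PiM prob_mu)

lemma sets_mu [measurable_cong]: "sets \<mu> = sets (borel \<Otimes>\<^sub>M S)"
  by (intro sets_pair_measure_cong sets_nu) simp

lemma sets_Q [measurable_cong]: "sets Q = sets Tree"
  by (intro sets_PiM_cong sets_mu refl)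

lemma measurable_W: "\<theta> \<in> Theta \<Longrightarrow> W \<theta> \<in> P \<rightarrow>\<^sub>M borel \<Otimes>\<^sub>M S"
  using W_indep by (auto simp: indep_vars_def2)

lemma measurable_D [measurable]: "D \<theta> \<in> P \<rightarrow>\<^sub>M Tree"
  unfolding D_def subtree_def by (intro measurable_restrict measurable_W) (auto simp: Theta_iff)

lemma measurable_mlp_compose [measurable (raw)]:
  assumes "f \<in> M \<rightarrow>\<^sub>M borel" "g \<in> M \<rightarrow>\<^sub>M Tree"
  shows "(\<lambda>x. \<Phi> m n (f x) (g x)) \<in> M \<rightarrow>\<^sub>M borel"
  using measurable_compose[OF measurable_Pair[OF assms] measurable_mlp[OF F_meas]] by simp

lemma measurable_Y [measurable]: "Y \<in> borel_measurable borel"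
  by (rule borel_measurable_continuous_onI) (rule Y_cont)

text \<open>Prepending \<theta> is injective, so the labels below \<theta> are again independent,
  with the same common law.\<close>

lemma distr_D: "distr P Tree (D \<theta>) = Q"
proof -
  have "inj_on ((@) \<theta>) Theta" by (auto intro: inj_onI)
  moreover have "indep_vars (\<lambda>_. borel \<Otimes>\<^sub>M S) W ((@) \<theta> ` Theta)"
    using W_indep by (rule indep_vars_subset) (auto simp: Theta_iff)
  ultimately have "indep_vars (\<lambda>_. borel \<Otimes>\<^sub>M S) (\<lambda>\<eta>. W (\<theta> @ \<eta>)) Theta"
    by (rule indep_vars_reindex)
  moreover have "Theta \<noteq> {}" by (auto simp: Theta_iff)
  moreover have node: "\<theta> @ \<eta> \<in> Theta" if "\<eta> \<in> Theta" for \<eta> using that by (auto simp: Theta_iff)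
  ultimately have "distr P Tree (\<lambda>\<omega>. \<lambda>\<eta>\<in>Theta. W (\<theta> @ \<eta>) \<omega>)
      = PiM Theta (\<lambda>\<eta>. distr P (borel \<Otimes>\<^sub>M S) (W (\<theta> @ \<eta>)))"
    using measurable_W by (subst (asm) indep_vars_iff_distr_eq_PiM') auto
  also have "\<dots> = Q"
    using node by (intro PiM_cong) (auto simp: W_distr)
  also have "(\<lambda>\<omega>. \<lambda>\<eta>\<in>Theta. W (\<theta> @ \<eta>) \<omega>) = D \<theta>" by (simp add: D_def subtree_def fun_eq_iff)
  finally show ?thesis .
qed

text \<open>\<open>W \<zeta>\<close> is not among the data seen by \<open>D \<theta>\<close>, hence independent of it.\<close>

definition fresh :: "int list \<Rightarrow> int list \<Rightarrow> bool" where
  "fresh \<zeta> \<theta> \<longleftrightarrow> \<zeta> \<in> Theta \<and> \<zeta> \<notin> (@) \<theta> ` Theta"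

lemma distr_W_D:
  assumes "fresh \<zeta> \<theta>"
  shows "distr P ((borel \<Otimes>\<^sub>M S) \<Otimes>\<^sub>M Tree) (\<lambda>\<omega>. (W \<zeta> \<omega>, D \<theta> \<omega>)) = \<mu> \<Otimes>\<^sub>M Q"
proof -
  have \<zeta>: "\<zeta> \<in> Theta" using assms by (simp add: fresh_def)
  txt \<open>\<open>W \<zeta>\<close> is viewed as a tree with one node, since \<open>indep_var\<close> needs a common value type.\<close>
  let ?M = "PiM {\<zeta>} (\<lambda>_. borel \<Otimes>\<^sub>M S :: (real \<times> 's) measure)" and ?R = "\<lambda>\<omega>. \<lambda>\<eta>\<in>{\<zeta>}. W \<eta> \<omega>"
  have "indep_var ?M ?R
      (PiM ((@) \<theta> ` Theta) (\<lambda>_. borel \<Otimes>\<^sub>M S)) (\<lambda>\<omega>. \<lambda>\<eta>\<in>(@) \<theta> ` Theta. W \<eta> \<omega>)"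
    using assms by (intro indep_var_restrict[OF W_indep]) (auto simp: fresh_def Theta_iff)
  moreover have "(\<lambda>v. v) \<in> PiM {\<zeta>} (\<lambda>_. borel \<Otimes>\<^sub>M S) \<rightarrow>\<^sub>M PiM {\<zeta>} (\<lambda>_. borel \<Otimes>\<^sub>M S :: (real \<times> 's) measure)"
    by measurable
  moreover have "subtree \<theta> \<in> PiM ((@) \<theta> ` Theta) (\<lambda>_. borel \<Otimes>\<^sub>M S) \<rightarrow>\<^sub>M Tree"
    unfolding subtree_def by (intro measurable_restrict measurable_component_singleton) simp
  ultimately have "indep_var (PiM {\<zeta>} (\<lambda>_. borel \<Otimes>\<^sub>M S)) ((\<lambda>v. v) \<circ> (\<lambda>\<omega>. \<lambda>\<eta>\<in>{\<zeta>}. W \<eta> \<omega>))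
      Tree (subtree \<theta> \<circ> (\<lambda>\<omega>. \<lambda>\<eta>\<in>(@) \<theta> ` Theta. W \<eta> \<omega>))"
    by (rule indep_var_compose)
  also have "(\<lambda>v. v) \<circ> (\<lambda>\<omega>. \<lambda>\<eta>\<in>{\<zeta>}. W \<eta> \<omega>) = ?R" by auto
  also have "subtree \<theta> \<circ> (\<lambda>\<omega>. \<lambda>\<eta>\<in>(@) \<theta> ` Theta. W \<eta> \<omega>) = D \<theta>"
    by (auto simp: D_def subtree_def fun_eq_iff)
  finally have R: "?R \<in> P \<rightarrow>\<^sub>M ?M" and joint: "distr P ?M ?R \<Otimes>\<^sub>M Q = distr P (?M \<Otimes>\<^sub>M Tree) (\<lambda>\<omega>. (?R \<omega>, D \<theta> \<omega>))"
    unfolding indep_var_distribution_eq distr_D by auto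
  have ev: "(\<lambda>v. v \<zeta>) \<in> ?M \<rightarrow>\<^sub>M borel \<Otimes>\<^sub>M S" by (rule measurable_component_singleton) simp
  have "distr (distr P ?M ?R) (borel \<Otimes>\<^sub>M S) (\<lambda>v. v \<zeta>) = distr P (borel \<Otimes>\<^sub>M S) (W \<zeta>)"
    by (subst distr_distr[OF ev R]) (simp add: comp_def)
  then have "\<mu> \<Otimes>\<^sub>M Q = distr (distr P ?M ?R) (borel \<Otimes>\<^sub>M S) (\<lambda>v. v \<zeta>) \<Otimes>\<^sub>M distr Q Tree (\<lambda>w. w)"
    using W_distr[OF \<zeta>] distr_id2[OF sets_Q[symmetric]] by simp
  also have "\<dots> = distr (distr P ?M ?R \<Otimes>\<^sub>M Q) ((borel \<Otimes>\<^sub>M S) \<Otimes>\<^sub>M Tree) (\<lambda>(v, w). (v \<zeta>, w))"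
  proof (rule pair_measure_distr)
    show "(\<lambda>v. v \<zeta>) \<in> distr P ?M ?R \<rightarrow>\<^sub>M borel \<Otimes>\<^sub>M S" using ev by simp
    show "(\<lambda>w. w) \<in> Q \<rightarrow>\<^sub>M Tree" by measurable
    show "sigma_finite_measure (distr Q Tree (\<lambda>w. w))"
      using distr_id2[OF sets_Q[symmetric]] prob_space_imp_sigma_finite[OF prob_Q] by simp
  qed
  also have "\<dots> = distr P ((borel \<Otimes>\<^sub>M S) \<Otimes>\<^sub>M Tree) ((\<lambda>(v, w). (v \<zeta>, w)) \<circ> (\<lambda>\<omega>. (?R \<omega>, D \<theta> \<omega>)))"
  proof -
    have "(\<lambda>(v, w). (v \<zeta>, w)) \<in> ?M \<Otimes>\<^sub>M Tree \<rightarrow>\<^sub>M (borel \<Otimes>\<^sub>M S) \<Otimes>\<^sub>M Tree"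
      unfolding split_beta by (intro measurable_Pair measurable_compose[OF measurable_fst ev] measurable_snd)
    then show ?thesis
      unfolding joint by (rule distr_distr[OF _ measurable_Pair[OF R measurable_D]])
  qed
  also have "(\<lambda>(v, w). (v \<zeta>, w)) \<circ> (\<lambda>\<omega>. (?R \<omega>, D \<theta> \<omega>)) = (\<lambda>\<omega>. (W \<zeta> \<omega>, D \<theta> \<omega>))" by auto
  finally show ?thesis ..
qed

lemma snd_W_space: "\<zeta> \<in> Theta \<Longrightarrow> \<omega> \<in> space P \<Longrightarrow> snd (W \<zeta> \<omega>) \<in> space S"
  using measurable_space[OF measurable_W, of \<zeta> \<omega>] by (auto simp: space_pair_measure)

lemma C0_nonneg: "C0 \<ge> 0"
  unfolding C0_def by simp

lemma nn_integral_F_xi: "(\<integral>\<^sup>+s. ennreal ((norm (F (\<xi>, s)))\<^sup>2) \<partial>\<nu>) = ennreal C0"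
  unfolding C0_def by (intro nn_integral_eq_integral integrableI_nonneg) (use F_xi in auto)

lemma nn_integral_W:
  assumes "\<zeta> \<in> Theta" and f: "f \<in> borel_measurable (borel \<Otimes>\<^sub>M S)"
  shows "(\<integral>\<^sup>+\<omega>. f (W \<zeta> \<omega>) \<partial>P) = (\<integral>\<^sup>+p. f p \<partial>\<mu>)"
  unfolding W_distr[OF assms(1), symmetric]
  using measurable_W[OF assms(1)] f by (subst nn_integral_distr) auto

lemma nn_integral_W_fst:
  assumes "\<zeta> \<in> Theta" and [measurable]: "f \<in> borel_measurable borel"
  shows "(\<integral>\<^sup>+\<omega>. f (fst (W \<zeta> \<omega>)) \<partial>P) = (\<integral>\<^sup>+r. f r \<partial>U)"
proof -
  interpret nu: prob_space \<nu> by (rule prob_nu)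
  have "(\<integral>\<^sup>+\<omega>. f (fst (W \<zeta> \<omega>)) \<partial>P) = (\<integral>\<^sup>+p. f (fst p) \<partial>\<mu>)"
    using assms(1) by (rule nn_integral_W) measurable
  also have "\<dots> = (\<integral>\<^sup>+r. \<integral>\<^sup>+s. f (fst (r, s)) \<partial>\<nu> \<partial>U)"
    by (rule nu.nn_integral_fst[symmetric]) measurable
  also have "\<dots> = (\<integral>\<^sup>+r. f r \<partial>U)" by (simp add: nu.emeasure_space_1)
  finally show ?thesis .
qed

lemma nn_integral_W_snd:
  assumes "\<zeta> \<in> Theta" and [measurable]: "f \<in> borel_measurable S"
  shows "(\<integral>\<^sup>+\<omega>. f (snd (W \<zeta> \<omega>)) \<partial>P) = (\<integral>\<^sup>+s. f s \<partial>\<nu>)"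
proof -
  interpret nu: prob_space \<nu> by (rule prob_nu)
  interpret U: prob_space U by (rule prob_U)
  have "(\<integral>\<^sup>+\<omega>. f (snd (W \<zeta> \<omega>)) \<partial>P) = (\<integral>\<^sup>+p. f (snd p) \<partial>\<mu>)"
    using assms(1) by (rule nn_integral_W) measurable
  also have "\<dots> = (\<integral>\<^sup>+r. \<integral>\<^sup>+s. f (snd (r, s)) \<partial>\<nu> \<partial>U)"
    by (rule nu.nn_integral_fst[symmetric]) measurable
  also have "\<dots> = (\<integral>\<^sup>+s. f s \<partial>\<nu>)" using U.emeasure_space_1 by simp
  finally show ?thesis .
qed

lemma measurable_err [measurable]: "err m n \<in> borel_measurable borel"
proof -
  interpret Q: prob_space Q by (rule prob_Q)
  show ?thesis unfolding err_def by measurable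
qed

lemma err_eq_expectation:
  "(\<integral>\<^sup>+\<omega>. ennreal ((norm (\<Phi> m n s (D \<theta> \<omega>) - Y s))\<^sup>2) \<partial>P) = err m n s"
  unfolding err_def distr_D[of \<theta>, symmetric] by (subst nn_integral_distr) measurable

text \<open>The random time is independent of the subtree: by Fubini the subtree is integrated
  first, with the time frozen, and this produces \<open>err\<close> at that time.\<close>

lemma nn_integral_child_error:
  assumes fresh: "fresh \<zeta> \<theta>"
  shows "(\<integral>\<^sup>+\<omega>. ennreal ((norm (\<Phi> m n (fst (W \<zeta> \<omega>) * t) (D \<theta> \<omega>) - Y (fst (W \<zeta> \<omega>) * t)))\<^sup>2) \<partial>P)
    = (\<integral>\<^sup>+\<omega>. err m n (fst (W \<zeta> \<omega>) * t) \<partial>P)"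
proof -
  interpret Q: prob_space Q by (rule prob_Q)
  have \<zeta>: "\<zeta> \<in> Theta" using fresh by (simp add: fresh_def)
  note [measurable] = measurable_W[OF \<zeta>]
  let ?h = "\<lambda>p :: (real \<times> 's) \<times> (int list \<Rightarrow> real \<times> 's).
    ennreal ((norm (\<Phi> m n (fst (fst p) * t) (snd p) - Y (fst (fst p) * t)))\<^sup>2)"
  have h: "?h \<in> borel_measurable ((borel \<Otimes>\<^sub>M S) \<Otimes>\<^sub>M Tree)" by measurable
  have "(\<integral>\<^sup>+\<omega>. ?h (W \<zeta> \<omega>, D \<theta> \<omega>) \<partial>P) = (\<integral>\<^sup>+p. ?h p \<partial>(\<mu> \<Otimes>\<^sub>M Q))"
    unfolding distr_W_D[OF fresh, symmetric] by (subst nn_integral_distr) (use h in measurable)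
  also have "\<dots> = (\<integral>\<^sup>+x. \<integral>\<^sup>+w. ?h (x, w) \<partial>Q \<partial>\<mu>)"
    by (rule Q.nn_integral_fst[symmetric]) (use h in measurable)
  also have "\<dots> = (\<integral>\<^sup>+x. err m n (fst x * t) \<partial>\<mu>)" by (simp add: err_def)
  also have "\<dots> = (\<integral>\<^sup>+\<omega>. err m n (fst (W \<zeta> \<omega>) * t) \<partial>P)"
    by (rule nn_integral_W[OF \<zeta>, symmetric]) measurable
  finally show ?thesis by simp
qed

text \<open>A pointwise bound growing like exp(m s) is averaged over the uniform random time;
  dividing by \<open>m * t\<close> is the gain that drives the induction.\<close>

lemma child_error_le:
  assumes fresh: "fresh \<zeta> \<theta>" and t: "0 < t" "t \<le> T" and m: "m \<ge> 1" and b: "b \<ge> 0"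
    and bound: "\<And>s. s \<in> {0..T} \<Longrightarrow> err m n s \<le> ennreal (b * exp (real m * s))"
  shows "(\<integral>\<^sup>+\<omega>. ennreal ((norm (\<Phi> m n (fst (W \<zeta> \<omega>) * t) (D \<theta> \<omega>) - Y (fst (W \<zeta> \<omega>) * t)))\<^sup>2) \<partial>P)
    \<le> ennreal (b * (exp (real m * t) / (real m * t)))"
proof -
  have \<zeta>: "\<zeta> \<in> Theta" using fresh by (simp add: fresh_def)
  have "(\<integral>\<^sup>+\<omega>. err m n (fst (W \<zeta> \<omega>) * t) \<partial>P)
      \<le> (\<integral>\<^sup>+\<omega>. ennreal b * ennreal (exp (real m * t * fst (W \<zeta> \<omega>))) \<partial>P)"
  proof (rule nn_integral_mono)
    fix \<omega> assume "\<omega> \<in> space P"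
    then have r: "fst (W \<zeta> \<omega>) \<in> {0..1}" using W_range[OF \<zeta>] by blast
    then have "fst (W \<zeta> \<omega>) * t \<le> t" using t by (simp add: mult_left_le_one_le)
    then have "fst (W \<zeta> \<omega>) * t \<le> T" using t(2) by (rule order_trans)
    then have "fst (W \<zeta> \<omega>) * t \<in> {0..T}" using r t by simp
    from bound[OF this] show "err m n (fst (W \<zeta> \<omega>) * t) \<le> ennreal b * ennreal (exp (real m * t * fst (W \<zeta> \<omega>)))"
      using b by (simp add: ennreal_mult mult_ac)
  qed
  also have "\<dots> = (\<integral>\<^sup>+r. ennreal b * ennreal (exp (real m * t * r)) \<partial>U)"
    by (rule nn_integral_W_fst[OF \<zeta>]) measurable
  also have "\<dots> = ennreal b * (\<integral>\<^sup>+r. ennreal (exp (real m * t * r)) \<partial>U)"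
    by (rule nn_integral_cmult) measurable
  also have "\<dots> \<le> ennreal b * ennreal (exp (real m * t) / (real m * t))"
    using t m by (intro mult_left_mono nn_integral_uniform_exp) auto
  also have "\<dots> = ennreal (b * (exp (real m * t) / (real m * t)))"
    using b t by (intro ennreal_mult[symmetric]) auto
  finally show ?thesis unfolding nn_integral_child_error[OF fresh] .
qed

section \<open>Means and second moments of the summands\<close>

text \<open>Two nodes are needed: time and realization of Z come from \<zeta>, the data of the
  approximation from \<theta>. The subtracted term of a summand reads its label at (l,k) but its
  data at (l,-k).\<close>

definition F_child :: "nat \<Rightarrow> nat \<Rightarrow> real \<Rightarrow> int list \<Rightarrow> int list \<Rightarrow> 'w \<Rightarrow> 'a" where
  "F_child m l t \<zeta> \<theta> \<omega> = F (\<Phi> m l (fst (W \<zeta> \<omega>) * t) (D \<theta> \<omega>), snd (W \<zeta> \<omega>))"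

definition F_exact :: "real \<Rightarrow> int list \<Rightarrow> 'w \<Rightarrow> 'a" where
  "F_exact t \<zeta> \<omega> = F (Y (fst (W \<zeta> \<omega>) * t), snd (W \<zeta> \<omega>))"

text \<open>Written over the product law, so that the mean visibly depends on neither node. This is
  what lets the means of consecutive levels telescope.\<close>

definition mean_child :: "nat \<Rightarrow> nat \<Rightarrow> real \<Rightarrow> 'a" where
  "mean_child m l t = (\<integral>p. F (\<Phi> m l (fst (fst p) * t) (snd p), snd (fst p)) \<partial>(\<mu> \<Otimes>\<^sub>M Q))"

definition mean_exact :: "real \<Rightarrow> 'a" where
  "mean_exact t = (\<integral>p. F (Y (fst p * t), snd p) \<partial>\<mu>)"

lemma measurable_F_child: "\<zeta> \<in> Theta \<Longrightarrow> F_child m l t \<zeta> \<theta> \<in> borel_measurable P"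
proof -
  assume "\<zeta> \<in> Theta"
  note [measurable] = measurable_W[OF this]
  show ?thesis unfolding F_child_def by measurable
qed

lemma measurable_F_exact: "\<zeta> \<in> Theta \<Longrightarrow> F_exact t \<zeta> \<in> borel_measurable P"
proof -
  assume "\<zeta> \<in> Theta"
  note [measurable] = measurable_W[OF this]
  show ?thesis unfolding F_exact_def by measurable
qed

lemma expectation_F_child:
  assumes fresh: "fresh \<zeta> \<theta>"
  shows "expectation (F_child m l t \<zeta> \<theta>) = mean_child m l t"
proof -
  have "\<zeta> \<in> Theta" using fresh by (simp add: fresh_def)
  note [measurable] = measurable_W[OF this]
  let ?h = "\<lambda>p :: (real \<times> 's) \<times> (int list \<Rightarrow> real \<times> 's). F (\<Phi> m l (fst (fst p) * t) (snd p), snd (fst p))"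
  have "?h \<in> borel_measurable ((borel \<Otimes>\<^sub>M S) \<Otimes>\<^sub>M Tree)" by measurable
  then have "(\<integral>p. ?h p \<partial>(\<mu> \<Otimes>\<^sub>M Q)) = (\<integral>\<omega>. ?h (W \<zeta> \<omega>, D \<theta> \<omega>) \<partial>P)"
    unfolding distr_W_D[OF fresh, symmetric] by (intro integral_distr) measurable
  then show ?thesis by (simp add: mean_child_def F_child_def[abs_def])
qed

lemma expectation_F_exact:
  assumes \<zeta>: "\<zeta> \<in> Theta"
  shows "expectation (F_exact t \<zeta>) = mean_exact t"
proof -
  note [measurable] = measurable_W[OF \<zeta>]
  have "(\<integral>p. F (Y (fst p * t), snd p) \<partial>\<mu>) = (\<integral>\<omega>. F (Y (fst (W \<zeta> \<omega>) * t), snd (W \<zeta> \<omega>)) \<partial>P)"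
    unfolding W_distr[OF \<zeta>, symmetric] by (intro integral_distr) measurable
  then show ?thesis by (simp add: mean_exact_def F_exact_def[abs_def])
qed

lemma F_sq_le:
  assumes "s \<in> space S"
  shows "(norm (F (x, s) - F (y, s)))\<^sup>2 \<le> L\<^sup>2 * (norm (x - y))\<^sup>2"
  unfolding power_mult_distrib[symmetric] using F_lip[OF assms, of x y] by (intro power_mono) auto

text \<open>By the Lipschitz condition and the bound \<open>C\<close> on \<open>Y - \<xi>\<close>,
  the value differs from \<open>F (\<xi>, Z)\<close> by at most \<open>L * C\<close>.\<close>

lemma square_integrable_F_exact:
  assumes \<zeta>: "\<zeta> \<in> Theta"
  shows "integrable P (\<lambda>\<omega>. (norm (F_exact t \<zeta> \<omega>))\<^sup>2)"
proof -
  note [measurable] = measurable_W[OF \<zeta>] measurable_F_exact[OF \<zeta>]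
  have "(\<integral>\<^sup>+\<omega>. ennreal ((norm (F (\<xi>, snd (W \<zeta> \<omega>))))\<^sup>2) \<partial>P) = ennreal C0"
    unfolding nn_integral_F_xi[symmetric] by (rule nn_integral_W_snd[OF \<zeta>]) measurable
  then have i: "integrable P (\<lambda>\<omega>. (norm (F (\<xi>, snd (W \<zeta> \<omega>))))\<^sup>2)"
    by (intro integrable_sq_of_nn_integral(1)[of _ C0]) (auto simp: C0_nonneg)
  show ?thesis
  proof (rule Bochner_Integration.integrable_bound)
    show "integrable P (\<lambda>\<omega>. 2 * (L\<^sup>2 * C\<^sup>2) + 2 * (norm (F (\<xi>, snd (W \<zeta> \<omega>))))\<^sup>2)"
      using i by simp
    show "AE \<omega> in P. norm ((norm (F_exact t \<zeta> \<omega>))\<^sup>2) \<le> norm (2 * (L\<^sup>2 * C\<^sup>2) + 2 * (norm (F (\<xi>, snd (W \<zeta> \<omega>))))\<^sup>2)"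
    proof (rule AE_I2)
      fix \<omega> assume "\<omega> \<in> space P"
      then have s: "snd (W \<zeta> \<omega>) \<in> space S" by (rule snd_W_space[OF \<zeta>])
      let ?y = "Y (fst (W \<zeta> \<omega>) * t)"
      have "(norm (F_exact t \<zeta> \<omega>))\<^sup>2 \<le> 2 * (norm (F (?y, snd (W \<zeta> \<omega>)) - F (\<xi>, snd (W \<zeta> \<omega>))))\<^sup>2
          + 2 * (norm (F (\<xi>, snd (W \<zeta> \<omega>))))\<^sup>2"
        using norm_add_sq_le[of "F (?y, snd (W \<zeta> \<omega>)) - F (\<xi>, snd (W \<zeta> \<omega>))" "F (\<xi>, snd (W \<zeta> \<omega>))"]
        by (simp add: F_exact_def)
      also have "(norm (F (?y, snd (W \<zeta> \<omega>)) - F (\<xi>, snd (W \<zeta> \<omega>))))\<^sup>2 \<le> L\<^sup>2 * (norm (?y - \<xi>))\<^sup>2"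
        by (rule F_sq_le[OF s])
      also have "(norm (?y - \<xi>))\<^sup>2 \<le> C\<^sup>2" by (intro power_mono Y_bound) simp
      finally show "norm ((norm (F_exact t \<zeta> \<omega>))\<^sup>2) \<le> norm (2 * (L\<^sup>2 * C\<^sup>2) + 2 * (norm (F (\<xi>, snd (W \<zeta> \<omega>))))\<^sup>2)"
        by (simp add: mult_left_mono)
    qed
  qed measurable
qed

text \<open>The integral equation read probabilistically: its time integral is t times the mean of
  \<open>F\<close> at a uniform random time. Hence the bias of the scheme is a difference of two
  means.\<close>

lemma scaled_mean_exact:
  assumes t: "0 < t" "t \<le> T"
  shows "t *\<^sub>R mean_exact t = Y t - \<xi>"
proof -
  interpret nu: prob_space \<nu> by (rule prob_nu)
  interpret U: prob_space U by (rule prob_U)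
  interpret pair_sigma_finite U \<nu> ..
  \<comment> \<open>Any node serves as a witness; it transports integrability from \<open>P\<close>
    to the law of a label, as Fubini requires.\<close>
  have \<zeta>: "[0] \<in> Theta" by (simp add: Theta_iff)
  note [measurable] = measurable_W[OF \<zeta>] measurable_F_exact[OF \<zeta>]
  have "integrable P (F_exact t [0])"
    by (rule integrable_norm_sq[OF measurable_F_exact[OF \<zeta>] square_integrable_F_exact[OF \<zeta>]])
  then have "integrable (distr P (borel \<Otimes>\<^sub>M S) (W [0])) (\<lambda>p. F (Y (fst p * t), snd p))"
    by (subst integrable_distr_eq) (auto simp: F_exact_def[abs_def])
  then have "integrable \<mu> (\<lambda>p. F (Y (fst p * t), snd p))" unfolding W_distr[OF \<zeta>] .
  then have "mean_exact t = (\<integral>r. \<integral>s. F (Y (r * t), s) \<partial>\<nu> \<partial>U)"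
    unfolding mean_exact_def by (subst integral_fst'[symmetric]) simp_all
  then have "t *\<^sub>R mean_exact t = (LINT r:{0..t}|lborel. (LINT s|\<nu>. F (Y r, s)))"
    using integral_uniform_scale[OF t(1), of "\<lambda>r. LINT s|\<nu>. F (Y r, s)"] by simp
  then show ?thesis using Y_eq[of t] t by simp
qed

text \<open>The two values of \<open>F\<close> share their label at \<zeta>, so the Lipschitz
  condition reduces their difference to the error of the child at a random time. The estimate for
  the means follows by Jensen's inequality.\<close>

lemma
  assumes fresh: "fresh \<zeta> \<theta>" and t: "0 < t" "t \<le> T" and m: "m \<ge> 1" and b: "b \<ge> 0"
    and bound: "\<And>s. s \<in> {0..T} \<Longrightarrow> err m l s \<le> ennreal (b * exp (real m * s))"
  defines "J \<equiv> exp (real m * t) / (real m * t)"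
  shows square_integrable_child_diff: "integrable P (\<lambda>\<omega>. (norm (F_child m l t \<zeta> \<theta> \<omega> - F_exact t \<zeta> \<omega>))\<^sup>2)"
    and expectation_child_diff_sq: "expectation (\<lambda>\<omega>. (norm (F_child m l t \<zeta> \<theta> \<omega> - F_exact t \<zeta> \<omega>))\<^sup>2) \<le> L\<^sup>2 * (b * J)"
    and square_integrable_F_child: "integrable P (\<lambda>\<omega>. (norm (F_child m l t \<zeta> \<theta> \<omega>))\<^sup>2)"
    and mean_diff_sq: "(norm (mean_child m l t - mean_exact t))\<^sup>2 \<le> L\<^sup>2 * (b * J)"
proof -
  have \<zeta>: "\<zeta> \<in> Theta" using fresh by (simp add: fresh_def)
  note [measurable] = measurable_W[OF \<zeta>] measurable_F_child[OF \<zeta>] measurable_F_exact[OF \<zeta>]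
  have J: "J \<ge> 0" using t m by (simp add: J_def)
  have "(\<integral>\<^sup>+\<omega>. ennreal ((norm (F_child m l t \<zeta> \<theta> \<omega> - F_exact t \<zeta> \<omega>))\<^sup>2) \<partial>P)
      \<le> (\<integral>\<^sup>+\<omega>. ennreal (L\<^sup>2) * ennreal ((norm (\<Phi> m l (fst (W \<zeta> \<omega>) * t) (D \<theta> \<omega>) - Y (fst (W \<zeta> \<omega>) * t)))\<^sup>2) \<partial>P)"
  proof (rule nn_integral_mono)
    fix \<omega> assume "\<omega> \<in> space P"
    then have s: "snd (W \<zeta> \<omega>) \<in> space S" by (rule snd_W_space[OF \<zeta>])
    show "ennreal ((norm (F_child m l t \<zeta> \<theta> \<omega> - F_exact t \<zeta> \<omega>))\<^sup>2)
      \<le> ennreal (L\<^sup>2) * ennreal ((norm (\<Phi> m l (fst (W \<zeta> \<omega>) * t) (D \<theta> \<omega>) - Y (fst (W \<zeta> \<omega>) * t)))\<^sup>2)"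
      unfolding F_child_def F_exact_def ennreal_mult'[OF zero_le_power2, symmetric]
      by (intro ennreal_leI F_sq_le s)
  qed
  also have "\<dots> = ennreal (L\<^sup>2) * (\<integral>\<^sup>+\<omega>. ennreal ((norm (\<Phi> m l (fst (W \<zeta> \<omega>) * t) (D \<theta> \<omega>) - Y (fst (W \<zeta> \<omega>) * t)))\<^sup>2) \<partial>P)"
    by (rule nn_integral_cmult) measurable
  also have "\<dots> \<le> ennreal (L\<^sup>2) * ennreal (b * J)"
    unfolding J_def by (intro mult_left_mono child_error_le fresh t m b bound) auto
  also have "\<dots> = ennreal (L\<^sup>2 * (b * J))" using b J by (intro ennreal_mult[symmetric]) auto
  finally have le: "(\<integral>\<^sup>+\<omega>. ennreal ((norm (F_child m l t \<zeta> \<theta> \<omega> - F_exact t \<zeta> \<omega>))\<^sup>2) \<partial>P) \<le> ennreal (L\<^sup>2 * (b * J))" .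
  have nonneg: "L\<^sup>2 * (b * J) \<ge> 0" using b J by simp
  show sq: "integrable P (\<lambda>\<omega>. (norm (F_child m l t \<zeta> \<theta> \<omega> - F_exact t \<zeta> \<omega>))\<^sup>2)"
    by (rule integrable_sq_of_nn_integral(1)[OF _ le nonneg]) measurable
  show le': "expectation (\<lambda>\<omega>. (norm (F_child m l t \<zeta> \<theta> \<omega> - F_exact t \<zeta> \<omega>))\<^sup>2) \<le> L\<^sup>2 * (b * J)"
    by (rule integrable_sq_of_nn_integral(2)[OF _ le nonneg]) measurable
  show sqA: "integrable P (\<lambda>\<omega>. (norm (F_child m l t \<zeta> \<theta> \<omega>))\<^sup>2)"
  proof (rule Bochner_Integration.integrable_bound)
    show "integrable P (\<lambda>\<omega>. 2 * (norm (F_child m l t \<zeta> \<theta> \<omega> - F_exact t \<zeta> \<omega>))\<^sup>2 + 2 * (norm (F_exact t \<zeta> \<omega>))\<^sup>2)"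
      using sq square_integrable_F_exact[OF \<zeta>] by simp
    show "AE \<omega> in P. norm ((norm (F_child m l t \<zeta> \<theta> \<omega>))\<^sup>2)
        \<le> norm (2 * (norm (F_child m l t \<zeta> \<theta> \<omega> - F_exact t \<zeta> \<omega>))\<^sup>2 + 2 * (norm (F_exact t \<zeta> \<omega>))\<^sup>2)"
    proof (rule AE_I2)
      fix \<omega>
      show "norm ((norm (F_child m l t \<zeta> \<theta> \<omega>))\<^sup>2)
        \<le> norm (2 * (norm (F_child m l t \<zeta> \<theta> \<omega> - F_exact t \<zeta> \<omega>))\<^sup>2 + 2 * (norm (F_exact t \<zeta> \<omega>))\<^sup>2)"
        using norm_add_sq_le[of "F_child m l t \<zeta> \<theta> \<omega> - F_exact t \<zeta> \<omega>" "F_exact t \<zeta> \<omega>"] by simp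
    qed
  qed measurable
  have iA: "integrable P (F_child m l t \<zeta> \<theta>)" and iL: "integrable P (F_exact t \<zeta>)"
    using integrable_norm_sq[OF measurable_F_child[OF \<zeta>] sqA]
      integrable_norm_sq[OF measurable_F_exact[OF \<zeta>] square_integrable_F_exact[OF \<zeta>]] by simp_all
  have "mean_child m l t - mean_exact t = expectation (\<lambda>\<omega>. F_child m l t \<zeta> \<theta> \<omega> - F_exact t \<zeta> \<omega>)"
    using iA iL by (simp add: expectation_F_child[OF fresh] expectation_F_exact[OF \<zeta>])
  then have "(norm (mean_child m l t - mean_exact t))\<^sup>2 \<le> expectation (\<lambda>\<omega>. (norm (F_child m l t \<zeta> \<theta> \<omega> - F_exact t \<zeta> \<omega>))\<^sup>2)"
    using norm_expectation_sq_le[OF Bochner_Integration.integrable_diff[OF iA iL] sq] by simp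
  then show "(norm (mean_child m l t - mean_exact t))\<^sup>2 \<le> L\<^sup>2 * (b * J)" using le' by simp
qed

text \<open>Each combination is a measurable function of the labels in one block, \<open>K1\<close>
  or \<open>K2\<close>, containing its node and both of its subtrees. Disjoint blocks of independent
  labels are independent.\<close>

lemma indep_F_child_combination:
  fixes c1 c2 :: real
  assumes "\<zeta>1 \<in> K1" "(@) \<zeta>1 ` Theta \<subseteq> K1" "(@) \<theta>1 ` Theta \<subseteq> K1" "K1 \<subseteq> Theta"
    and "\<zeta>2 \<in> K2" "(@) \<zeta>2 ` Theta \<subseteq> K2" "(@) \<theta>2 ` Theta \<subseteq> K2" "K2 \<subseteq> Theta" "K1 \<inter> K2 = {}"
  shows "indep_var borel (\<lambda>\<omega>. c1 *\<^sub>R (F_child m l1 t \<zeta>1 \<zeta>1 \<omega> - (if l1 = 0 then 0 else F_child m (l1 - 1) t \<zeta>1 \<theta>1 \<omega>)))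
     borel (\<lambda>\<omega>. c2 *\<^sub>R (F_child m l2 t \<zeta>2 \<zeta>2 \<omega> - (if l2 = 0 then 0 else F_child m (l2 - 1) t \<zeta>2 \<theta>2 \<omega>)))"
proof -
  \<comment> \<open>The summands as functions of an abstract label family, so that they can be
    evaluated on the family restricted to a block.\<close>
  define g where "g l \<zeta> \<theta> v = F (\<Phi> m l (fst (v \<zeta>) * t) (subtree \<theta> v), snd (v \<zeta>))" for l \<zeta> \<theta> v
  define h where "h c l \<zeta> \<theta> v = c *\<^sub>R (g l \<zeta> \<zeta> v - (if l = 0 then 0 else g (l - 1) \<zeta> \<theta> v))" for c :: real and l \<zeta> \<theta> v
  have g: "g l \<zeta> \<theta> \<in> PiM K (\<lambda>_. borel \<Otimes>\<^sub>M S) \<rightarrow>\<^sub>M borel" if "\<zeta> \<in> K" "(@) \<theta> ` Theta \<subseteq> K" for l \<zeta> \<theta> K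
  proof -
    have [measurable]: "(\<lambda>v. v \<zeta>) \<in> PiM K (\<lambda>_. borel \<Otimes>\<^sub>M S) \<rightarrow>\<^sub>M (borel \<Otimes>\<^sub>M S :: (real \<times> 's) measure)"
      using that(1) by (rule measurable_component_singleton)
    have [measurable]: "subtree \<theta> \<in> PiM K (\<lambda>_. borel \<Otimes>\<^sub>M S) \<rightarrow>\<^sub>M Tree"
      unfolding subtree_def using that(2) by (intro measurable_restrict measurable_component_singleton) auto
    show ?thesis unfolding g_def by measurable
  qed
  have h: "h c l \<zeta> \<theta> \<in> PiM K (\<lambda>_. borel \<Otimes>\<^sub>M S) \<rightarrow>\<^sub>M borel"
    if "\<zeta> \<in> K" "(@) \<zeta> ` Theta \<subseteq> K" "(@) \<theta> ` Theta \<subseteq> K" for c l \<zeta> \<theta> K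
    unfolding h_def using g[OF that(1,2)] g[OF that(1,3)]
    by (cases "l = 0") (simp_all add: borel_measurable_scaleR borel_measurable_diff)
  have g_A: "g l \<zeta> \<theta> (\<lambda>\<eta>\<in>K. W \<eta> \<omega>) = F_child m l t \<zeta> \<theta> \<omega>" if "\<zeta> \<in> K" "(@) \<theta> ` Theta \<subseteq> K" for l \<zeta> \<theta> K \<omega>
  proof -
    have "subtree \<theta> (\<lambda>\<eta>\<in>K. W \<eta> \<omega>) = D \<theta> \<omega>"
      using that(2) by (auto simp: subtree_def D_def fun_eq_iff restrict_def)
    then show ?thesis using that(1) by (simp add: g_def F_child_def)
  qed
  have "indep_var borel (h c1 l1 \<zeta>1 \<theta>1 \<circ> (\<lambda>\<omega>. \<lambda>\<eta>\<in>K1. W \<eta> \<omega>)) borel (h c2 l2 \<zeta>2 \<theta>2 \<circ> (\<lambda>\<omega>. \<lambda>\<eta>\<in>K2. W \<eta> \<omega>))"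
    using assms by (intro indep_var_compose[OF indep_var_restrict[OF W_indep]] h) auto
  moreover have "h c1 l1 \<zeta>1 \<theta>1 \<circ> (\<lambda>\<omega>. \<lambda>\<eta>\<in>K1. W \<eta> \<omega>)
      = (\<lambda>\<omega>. c1 *\<^sub>R (F_child m l1 t \<zeta>1 \<zeta>1 \<omega> - (if l1 = 0 then 0 else F_child m (l1 - 1) t \<zeta>1 \<theta>1 \<omega>)))"
    using assms by (simp add: fun_eq_iff h_def g_A)
  moreover have "h c2 l2 \<zeta>2 \<theta>2 \<circ> (\<lambda>\<omega>. \<lambda>\<eta>\<in>K2. W \<eta> \<omega>)
      = (\<lambda>\<omega>. c2 *\<^sub>R (F_child m l2 t \<zeta>2 \<zeta>2 \<omega> - (if l2 = 0 then 0 else F_child m (l2 - 1) t \<zeta>2 \<theta>2 \<omega>)))"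
    using assms by (simp add: fun_eq_iff h_def g_A)
  ultimately show ?thesis by simp
qed

text \<open>At level 0 nothing is subtracted and no smallness can be expected; the averaging over
  \<open>m ^ n\<close> samples will provide it.\<close>

lemma expectation_F_xi_sq:
  assumes \<zeta>: "\<zeta> \<in> Theta"
  shows "integrable P (\<lambda>\<omega>. (norm (F_child m 0 t \<zeta> \<theta> \<omega>))\<^sup>2)"
    and "expectation (\<lambda>\<omega>. (norm (F_child m 0 t \<zeta> \<theta> \<omega>))\<^sup>2) \<le> C0"
proof -
  have "(\<integral>\<^sup>+\<omega>. ennreal ((norm (F (\<xi>, snd (W \<zeta> \<omega>))))\<^sup>2) \<partial>P) = ennreal C0"
    unfolding nn_integral_F_xi[symmetric] by (rule nn_integral_W_snd[OF \<zeta>]) measurable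
  then have le: "(\<integral>\<^sup>+\<omega>. ennreal ((norm (F_child m 0 t \<zeta> \<theta> \<omega>))\<^sup>2) \<partial>P) \<le> ennreal C0"
    by (simp add: F_child_def)
  show "integrable P (\<lambda>\<omega>. (norm (F_child m 0 t \<zeta> \<theta> \<omega>))\<^sup>2)"
    by (rule integrable_sq_of_nn_integral(1)[OF measurable_F_child[OF \<zeta>] le C0_nonneg])
  show "expectation (\<lambda>\<omega>. (norm (F_child m 0 t \<zeta> \<theta> \<omega>))\<^sup>2) \<le> C0"
    by (rule integrable_sq_of_nn_integral(2)[OF measurable_F_child[OF \<zeta>] le C0_nonneg])
qed

section \<open>The error recursion\<close>

text \<open>Level \<open>l\<close> has \<open>m ^ (n - l)\<close> summands of weight
  \<open>t / m ^ (n - l)\<close>, so its variance carries the factor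
  \<open>t\<^sup>2 / m ^ (n - l)\<close>. The sum collects these levels, the first term is level 0,
  and the last term is the squared bias, in which only level \<open>n - 1\<close> survives the
  telescoping.\<close>

lemma err_step:
  assumes m: "m \<ge> 1" and n: "n \<ge> 1" and t: "0 < t" "t \<le> T" and b: "\<And>l. b l \<ge> 0"
    and bound: "\<And>l s. l < n \<Longrightarrow> s \<in> {0..T} \<Longrightarrow> err m l s \<le> ennreal (b l * exp (real m * s))"
  defines "e \<equiv> exp (real m * t)"
  shows "err m n t \<le> ennreal (T\<^sup>2 * C0 / real m ^ n
     + (\<Sum>l=1..n-1. (1 / real m ^ (n - l)) * (2 * (L\<^sup>2 * T * (e / m)) * (b l + b (l - 1))))
     + L\<^sup>2 * T * (e / m) * b (n - 1))"
proof -
  define J where "J = e / (real m * t)"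
  have J: "J \<ge> 0" using t m by (simp add: J_def e_def)
  define node where "node l k = [0, int l, int k]" for l k :: nat
  define node' where "node' l k = [0, int l, - int k]" for l k :: nat
  have Th: "node l k \<in> Theta" "node' l k \<in> Theta" for l k by (simp_all add: node_def node'_def Theta_iff)
  have fresh: "fresh (node l k) (node l k)" for l k
    by (auto simp: fresh_def Theta_iff node_def)
  have fresh': "fresh (node l k) (node' l k)" for l k
    by (auto simp: fresh_def Theta_iff node_def node'_def)
  define G where "G l k \<omega> = F_child m l t (node l k) (node l k) \<omega>
     - (if l = 0 then 0 else F_child m (l - 1) t (node l k) (node' l k) \<omega>)" for l k \<omega>
  \<comment> \<open>Bound on the second moment of one summand at level \<open>l\<close>, before its
    weight; the factor 2 comes from splitting at \<open>F_exact\<close>.\<close>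
  define \<gamma> where "\<gamma> l = (if l = 0 then C0 else 2 * L\<^sup>2 * J * (b l + b (l - 1)))" for l
  have sqA: "integrable P (\<lambda>\<omega>. (norm (F_child m l t (node l' k) \<theta> \<omega>))\<^sup>2)" if "fresh (node l' k) \<theta>" "l < n" for l l' k \<theta>
    using square_integrable_F_child[OF that(1) t m b bound[OF that(2)]] by blast
  have iA: "integrable P (F_child m l t (node l' k) \<theta>)" if "fresh (node l' k) \<theta>" "l < n" for l l' k \<theta>
    using integrable_norm_sq[OF measurable_F_child[OF Th(1)] sqA[OF that]] .
  have measG: "G l k \<in> borel_measurable P" for l k
    unfolding G_def using measurable_F_child[OF Th(1)]
    by (cases "l = 0") (simp_all add: borel_measurable_diff)
  have EG: "expectation (G l k) = mean_child m l t - (if l = 0 then 0 else mean_child m (l - 1) t)" if "l < n" for l k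
    using iA[OF fresh that] iA[OF fresh', of "l - 1" l k] that
    unfolding G_def by (simp add: expectation_F_child fresh fresh')
  have sqG: "integrable P (\<lambda>\<omega>. (norm (G l k \<omega>))\<^sup>2) \<and> expectation (\<lambda>\<omega>. (norm (G l k \<omega>))\<^sup>2) \<le> \<gamma> l" if l: "l < n" for l k
  proof (cases "l = 0")
    case True
    then show ?thesis using expectation_F_xi_sq[OF Th(1)] by (simp add: G_def \<gamma>_def)
  next
    case False
    \<comment> \<open>\<open>X1\<close> and \<open>X2\<close> subtract the same
      \<open>F_exact\<close>, since both terms use the label at \<open>node l k\<close>; it cancels
      in \<open>G l k = X1 - X2\<close>.\<close>
    define X1 where "X1 \<omega> = F_child m l t (node l k) (node l k) \<omega> - F_exact t (node l k) \<omega>" for \<omega>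
    define X2 where "X2 \<omega> = F_child m (l - 1) t (node l k) (node' l k) \<omega> - F_exact t (node l k) \<omega>" for \<omega>
    have l1: "l - 1 < n" using l by simp
    have X1: "integrable P (\<lambda>\<omega>. (norm (X1 \<omega>))\<^sup>2)" "expectation (\<lambda>\<omega>. (norm (X1 \<omega>))\<^sup>2) \<le> L\<^sup>2 * (b l * J)"
      using square_integrable_child_diff[OF fresh t m b bound[OF l]] expectation_child_diff_sq[OF fresh t m b bound[OF l]]
      unfolding X1_def J_def e_def by blast+
    have X2: "integrable P (\<lambda>\<omega>. (norm (X2 \<omega>))\<^sup>2)" "expectation (\<lambda>\<omega>. (norm (X2 \<omega>))\<^sup>2) \<le> L\<^sup>2 * (b (l - 1) * J)"
      using square_integrable_child_diff[OF fresh' t m b bound[OF l1]] expectation_child_diff_sq[OF fresh' t m b bound[OF l1]]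
      unfolding X2_def J_def e_def by blast+
    have le: "(norm (G l k \<omega>))\<^sup>2 \<le> 2 * (norm (X1 \<omega>))\<^sup>2 + 2 * (norm (X2 \<omega>))\<^sup>2" for \<omega>
      using norm_add_sq_le[of "X1 \<omega>" "- X2 \<omega>"] False by (simp add: G_def X1_def X2_def norm_minus_commute[of "F_exact t (node l k) \<omega>"])
    have int: "integrable P (\<lambda>\<omega>. 2 * (norm (X1 \<omega>))\<^sup>2 + 2 * (norm (X2 \<omega>))\<^sup>2)" using X1 X2 by simp
    have "integrable P (\<lambda>\<omega>. (norm (G l k \<omega>))\<^sup>2)"
      using measG[of l k] by (intro Bochner_Integration.integrable_bound[OF int]) (use le in auto)
    moreover from this have "expectation (\<lambda>\<omega>. (norm (G l k \<omega>))\<^sup>2) \<le> expectation (\<lambda>\<omega>. 2 * (norm (X1 \<omega>))\<^sup>2 + 2 * (norm (X2 \<omega>))\<^sup>2)"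
      using int by (rule integral_mono) (rule le)
    moreover have "expectation (\<lambda>\<omega>. 2 * (norm (X1 \<omega>))\<^sup>2 + 2 * (norm (X2 \<omega>))\<^sup>2)
        \<le> 2 * (L\<^sup>2 * (b l * J)) + 2 * (L\<^sup>2 * (b (l - 1) * J))"
      using X1 X2 by simp
    moreover have "2 * (L\<^sup>2 * (b l * J)) + 2 * (L\<^sup>2 * (b (l - 1) * J)) = \<gamma> l"
      using False by (simp add: \<gamma>_def algebra_simps)
    ultimately show ?thesis by linarith
  qed

  define c where "c l = t / real m ^ (n - l)" for l
  define I where "I = Sigma {..<n} (\<lambda>l. {1..m ^ (n - l)})"
  define V where "V p \<omega> = c (fst p) *\<^sub>R G (fst p) (snd p) \<omega>" for p \<omega>
  have finI: "finite I" by (simp add: I_def)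
  \<comment> \<open>The deterministic offset \<open>\<xi> - Y t\<close> enters only the bias, where
    it cancels against the exact mean.\<close>
  have decomp: "\<Phi> m n t (D [0] \<omega>) - Y t = (\<Sum>p\<in>I. V p \<omega>) + (\<xi> - Y t)" for \<omega>
  proof -
    have val: "D [0] \<omega> [int l, int k] = W (node l k) \<omega>" for l k
      by (simp add: D_def subtree_def node_def Theta_iff)
    have sub: "subtree [int l, int k] (D [0] \<omega>) = D (node l k) \<omega>"
      "subtree [int l, - int k] (D [0] \<omega>) = D (node' l k) \<omega>" for l k
      by (simp_all add: D_def subtree_subtree node_def node'_def)
    have "\<Phi> m n t (D [0] \<omega>) = \<xi> + (\<Sum>l<n. c l *\<^sub>R (\<Sum>k=1..m ^ (n - l). G l k \<omega>))"
      by (subst mlp.simps) (simp only: val sub G_def F_child_def c_def)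
    also have "(\<Sum>l<n. c l *\<^sub>R (\<Sum>k=1..m ^ (n - l). G l k \<omega>)) = (\<Sum>p\<in>I. V p \<omega>)"
      unfolding I_def V_def scaleR_sum_right by (subst sum.Sigma) (auto simp: split_beta)
    finally show ?thesis by simp
  qed
  have indep: "indep_var borel (V p) borel (V q)" if "p \<in> I" "q \<in> I" "p \<noteq> q" for p q
  proof -
    \<comment> \<open>The block of (l,k) consists of the nodes (l,k), (l,-k) and everything below
      them. Blocks of distinct pairs are disjoint because second entries in \<open>I\<close> are at
      least 1, so k never equals -k'.\<close>
    define K where "K p = {\<eta>. \<exists>\<rho>. \<eta> = node (fst p) (snd p) @ \<rho> \<or> \<eta> = node' (fst p) (snd p) @ \<rho>}" for p
    have "K p \<inter> K q = {}"
      using that by (auto simp: K_def node_def node'_def I_def prod_eq_iff)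
    moreover have "node (fst p) (snd p) \<in> K p" "(@) (node (fst p) (snd p)) ` Theta \<subseteq> K p"
      "(@) (node' (fst p) (snd p)) ` Theta \<subseteq> K p" "K p \<subseteq> Theta" for p
      by (auto simp: K_def node_def node'_def Theta_iff)
    ultimately show ?thesis unfolding V_def G_def by (intro indep_F_child_combination) auto
  qed
  have measV: "V p \<in> borel_measurable P" for p
    unfolding V_def using measG by (intro borel_measurable_scaleR) auto
  have sqV: "integrable P (\<lambda>\<omega>. (norm (V p \<omega>))\<^sup>2)"
    "expectation (\<lambda>\<omega>. (norm (V p \<omega>))\<^sup>2) \<le> (c (fst p))\<^sup>2 * \<gamma> (fst p)" if "p \<in> I" for p
  proof -
    have l: "fst p < n" using that by (auto simp: I_def)
    have eq: "(norm (V p \<omega>))\<^sup>2 = (c (fst p))\<^sup>2 * (norm (G (fst p) (snd p) \<omega>))\<^sup>2" for \<omega>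
      by (simp add: V_def power_mult_distrib)
    show "integrable P (\<lambda>\<omega>. (norm (V p \<omega>))\<^sup>2)" unfolding eq using sqG[OF l] by simp
    show "expectation (\<lambda>\<omega>. (norm (V p \<omega>))\<^sup>2) \<le> (c (fst p))\<^sup>2 * \<gamma> (fst p)"
      unfolding eq using sqG[OF l] by (simp add: mult_left_mono)
  qed
  note bv = bias_variance_indep_sum[where X=V and v="\<xi> - Y t", OF finI indep measV sqV(1)]
  \<comment> \<open>Stated for real vector spaces because it is applied both to the vector-valued
    means and to the real second moments.\<close>
  have card_sum: "(\<Sum>p\<in>I. f (fst p)) = (\<Sum>l<n. of_nat (m ^ (n - l)) *\<^sub>R f l)" for f :: "nat \<Rightarrow> 'x::real_vector"
  proof -
    have "(\<Sum>p\<in>I. f (fst p)) = (\<Sum>l<n. \<Sum>k=1..m ^ (n - l). f l)"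
      unfolding I_def by (subst sum.Sigma) (auto simp: split_beta)
    then show ?thesis by (simp add: sum_constant_scaleR)
  qed
  have mc: "real (m ^ (n - l)) * c l = t" for l using m by (simp add: c_def)
  have telescope: "(\<Sum>l<Suc j. mean_child m l t - (if l = 0 then 0 else mean_child m (l - 1) t)) = mean_child m j t" for j
    by (induction j) auto
  have mean: "(\<Sum>p\<in>I. expectation (V p)) + (\<xi> - Y t) = t *\<^sub>R (mean_child m (n - 1) t - mean_exact t)"
  proof -
    have "(\<Sum>p\<in>I. expectation (V p)) = (\<Sum>p\<in>I. c (fst p) *\<^sub>R (mean_child m (fst p) t - (if fst p = 0 then 0 else mean_child m (fst p - 1) t)))"
      by (intro sum.cong refl) (auto simp: V_def[abs_def] EG I_def)
    also have "\<dots> = (\<Sum>l<n. t *\<^sub>R (mean_child m l t - (if l = 0 then 0 else mean_child m (l - 1) t)))"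
      by (subst card_sum) (simp only: scaleR_scaleR mc of_nat_id)
    also have "\<dots> = t *\<^sub>R mean_child m (n - 1) t"
      using telescope[of "n - 1"] n by (simp flip: scaleR_sum_right)
    finally show ?thesis using scaled_mean_exact[OF t] by (simp add: scaleR_diff_right algebra_simps)
  qed
  \<comment> \<open>One factor t cancels the 1/t in \<open>J\<close>, the other is bounded by
    \<open>T\<close>; no negative power of t is left.\<close>
  have tJ: "t\<^sup>2 * J \<le> T * (e / m)"
  proof -
    have "t\<^sup>2 * J = t * (e / m)" using t by (simp add: J_def power2_eq_square)
    also have "\<dots> \<le> T * (e / m)" using t by (intro mult_right_mono) (auto simp: e_def)
    finally show ?thesis .
  qed
  have "expectation (\<lambda>\<omega>. (norm (\<Phi> m n t (D [0] \<omega>) - Y t))\<^sup>2)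
      \<le> (\<Sum>p\<in>I. expectation (\<lambda>\<omega>. (norm (V p \<omega>))\<^sup>2)) + (norm (t *\<^sub>R (mean_child m (n - 1) t - mean_exact t)))\<^sup>2"
    using bv unfolding decomp mean by blast
  also have "\<dots> \<le> (\<Sum>p\<in>I. (c (fst p))\<^sup>2 * \<gamma> (fst p)) + t\<^sup>2 * (L\<^sup>2 * (b (n - 1) * J))"
  proof (intro add_mono sum_mono sqV(2))
    have l: "n - 1 < n" using n by simp
    have "(norm (mean_child m (n - 1) t - mean_exact t))\<^sup>2 \<le> L\<^sup>2 * (b (n - 1) * J)"
      using mean_diff_sq[OF fresh t m b bound[OF l]] unfolding J_def e_def by blast
    then show "(norm (t *\<^sub>R (mean_child m (n - 1) t - mean_exact t)))\<^sup>2 \<le> t\<^sup>2 * (L\<^sup>2 * (b (n - 1) * J))"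
      by (simp add: power_mult_distrib mult_left_mono)
  qed
  also have "(\<Sum>p\<in>I. (c (fst p))\<^sup>2 * \<gamma> (fst p)) = (\<Sum>l<n. (t\<^sup>2 * \<gamma> l) / real m ^ (n - l))"
  proof (subst card_sum, intro sum.cong refl)
    fix l
    have "real (m ^ (n - l)) *\<^sub>R ((c l)\<^sup>2 * \<gamma> l) = (real (m ^ (n - l)) * c l) * (c l * \<gamma> l)"
      by (simp add: power2_eq_square)
    also have "\<dots> = (t\<^sup>2 * \<gamma> l) / real m ^ (n - l)"
      unfolding mc by (simp add: c_def power2_eq_square)
    finally show "real (m ^ (n - l)) *\<^sub>R ((c l)\<^sup>2 * \<gamma> l) = (t\<^sup>2 * \<gamma> l) / real m ^ (n - l)" .
  qed
  also have "\<dots> = t\<^sup>2 * C0 / real m ^ n + (\<Sum>l=1..n-1. (t\<^sup>2 * \<gamma> l) / real m ^ (n - l))"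
  proof -
    have "{..<n} = insert 0 {1..n-1}" using n by auto
    then show ?thesis by (simp add: \<gamma>_def)
  qed
  also have "\<dots> + t\<^sup>2 * (L\<^sup>2 * (b (n - 1) * J)) \<le> T\<^sup>2 * C0 / real m ^ n
     + (\<Sum>l=1..n-1. (1 / real m ^ (n - l)) * (2 * (L\<^sup>2 * T * (e / m)) * (b l + b (l - 1))))
     + L\<^sup>2 * T * (e / m) * b (n - 1)"
  proof (intro add_mono sum_mono)
    show "t\<^sup>2 * C0 / real m ^ n \<le> T\<^sup>2 * C0 / real m ^ n"
      using t C0_nonneg by (intro divide_right_mono mult_right_mono power_mono) auto
    have "(L\<^sup>2 * b (n - 1)) * (t\<^sup>2 * J) \<le> (L\<^sup>2 * b (n - 1)) * (T * (e / m))"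
      using tJ b by (intro mult_left_mono) auto
    then show "t\<^sup>2 * (L\<^sup>2 * (b (n - 1) * J)) \<le> L\<^sup>2 * T * (e / m) * b (n - 1)"
      by (simp add: mult_ac)
    fix l assume "l \<in> {1..n-1}"
    then have \<gamma>: "t\<^sup>2 * \<gamma> l = (2 * L\<^sup>2 * (b l + b (l - 1))) * (t\<^sup>2 * J)" by (simp add: \<gamma>_def)
    have "t\<^sup>2 * \<gamma> l \<le> (2 * L\<^sup>2 * (b l + b (l - 1))) * (T * (e / m))"
      unfolding \<gamma> using tJ b[of l] b[of "l - 1"] by (intro mult_left_mono) auto
    then have "(t\<^sup>2 * \<gamma> l) / real m ^ (n - l) \<le> (2 * L\<^sup>2 * (b l + b (l - 1))) * (T * (e / m)) / real m ^ (n - l)"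
      by (intro divide_right_mono) auto
    then show "(t\<^sup>2 * \<gamma> l) / real m ^ (n - l) \<le> (1 / real m ^ (n - l)) * (2 * (L\<^sup>2 * T * (e / m)) * (b l + b (l - 1)))"
      by (simp add: mult_ac)
  qed
  finally have main: "expectation (\<lambda>\<omega>. (norm (\<Phi> m n t (D [0] \<omega>) - Y t))\<^sup>2) \<le> \<dots>" .
  have "err m n t = (\<integral>\<^sup>+\<omega>. ennreal ((norm (\<Phi> m n t (D [0] \<omega>) - Y t))\<^sup>2) \<partial>P)"
    by (rule err_eq_expectation[symmetric])
  also have "\<dots> = ennreal (expectation (\<lambda>\<omega>. (norm (\<Phi> m n t (D [0] \<omega>) - Y t))\<^sup>2))"
  proof (rule nn_integral_eq_integral)
    show "integrable P (\<lambda>\<omega>. (norm (\<Phi> m n t (D [0] \<omega>) - Y t))\<^sup>2)"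
      unfolding decomp using bv by blast
  qed simp
  finally show ?thesis using ennreal_leI[OF main] by simp
qed

text \<open>The prefactor has two sources: \<open>T\<^sup>2 * C0\<close> covers the level-0 sampling
  error, and \<open>C\<^sup>2\<close> the start \<open>n = 0\<close>, where the approximation is the
  constant \<xi>. \<open>err_step\<close> and \<open>mlp_bound_recursion\<close> then reproduce the
  bound.\<close>

lemma err_bound:
  assumes m: "m \<ge> 1" and t: "t \<in> {0..T}"
  shows "err m n t \<le> ennreal ((T\<^sup>2 * C0 + C\<^sup>2) * (2 + 10 * (L\<^sup>2 * T)) ^ n / real m ^ n * exp (real m * t))"
  using t
proof (induction n arbitrary: t rule: less_induct)
  case (less n)
  interpret Q: prob_space Q by (rule prob_Q)
  define B where "B = T\<^sup>2 * C0 + C\<^sup>2"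
  define \<kappa> where "\<kappa> = 2 + 10 * (L\<^sup>2 * T)"
  have B: "B \<ge> 0" using C0_nonneg by (simp add: B_def)
  have K: "L\<^sup>2 * T \<ge> 0" using T by simp
  have \<kappa>0: "\<kappa> \<ge> 0" using K by (simp add: \<kappa>_def)
  have e: "exp (real m * t) \<ge> 1" using less.prems by simp
  consider "t = 0" | "n = 0" | "t > 0" "n \<ge> 1" using less.prems by fastforce
  then show ?case
  proof cases
    case 1
    have "(LINT r:{0..0}|lborel. (LINT s|\<nu>. F (Y r, s))) = 0"
      unfolding set_lebesgue_integral_def
      by (rule integral_eq_zero_AE) (use AE_lborel_singleton[of "0::real"] in \<open>eventually_elim, simp\<close>)
    then have "Y 0 = \<xi>" using Y_eq[of 0] T by simp
    then show ?thesis using 1 by (simp add: err_def mlp_time_0)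
  next
    case 2
    have "err m 0 t = ennreal ((norm (\<xi> - Y t))\<^sup>2)" by (simp add: err_def Q.emeasure_space_1)
    moreover have "(norm (\<xi> - Y t))\<^sup>2 \<le> B * exp (real m * t)"
    proof -
      have "(norm (\<xi> - Y t))\<^sup>2 \<le> C\<^sup>2"
        using Y_bound[of t] by (intro power_mono) (auto simp: norm_minus_commute)
      also have "C\<^sup>2 \<le> B * 1" using C0_nonneg by (simp add: B_def)
      also have "\<dots> \<le> B * exp (real m * t)" using B e by (intro mult_left_mono) auto
      finally show ?thesis .
    qed
    ultimately show ?thesis using 2 by (simp add: B_def ennreal_leI)
  next
    case 3
    define b where "b l = B * \<kappa> ^ l / real m ^ l" for l
    have b: "b l \<ge> 0" for l using B \<kappa>0 by (simp add: b_def)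
    have bound: "err m l s \<le> ennreal (b l * exp (real m * s))" if "l < n" "s \<in> {0..T}" for l s
      using less.IH[OF that] by (simp add: b_def B_def \<kappa>_def)
    have "t \<le> T" using less.prems by simp
    note err_step[OF m 3(2,1) this b bound]
    also have "T\<^sup>2 * C0 / real m ^ n
       + (\<Sum>l=1..n-1. (1 / real m ^ (n - l)) * (2 * (L\<^sup>2 * T * (exp (real m * t) / m)) * (b l + b (l - 1))))
       + L\<^sup>2 * T * (exp (real m * t) / m) * b (n - 1) \<le> B * \<kappa> ^ n / real m ^ n * exp (real m * t)"
      unfolding b_def
      by (rule mlp_bound_recursion[OF m 3(2) K e _ _ \<kappa>_def]) (simp_all add: B_def C0_nonneg)
    finally show ?thesis by (simp add: B_def \<kappa>_def ennreal_leI)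
  qed
qed

end

section \<open>The main result\<close>

lemma ennsqrt_le:
  assumes "x \<le> ennreal (e\<^sup>2)" "e \<ge> 0"
  shows "ennsqrt x \<le> ennreal e"
proof (cases x)
  case (real r)
  then have "r \<le> e\<^sup>2" using assms by simp
  then have "sqrt r \<le> e" using assms(2) real by (simp add: real_le_lsqrt)
  then show ?thesis using real by (simp add: ennsqrt_def ennreal_leI)
next
  case top
  then show ?thesis using assms by (simp add: top_unique)
qed

theorem theorem3p5:
  fixes T L :: real
    and \<NN> :: nat
    and \<xi> :: "real ^ 'd"
    and nrm :: "real ^ 'd \<Rightarrow> real"
    and S :: "'s measure"
    and F :: "(real ^ 'd) \<times> 's \<Rightarrow> real ^ 'd"
    and P :: "'w measure"
    and Z :: "int list \<Rightarrow> 'w \<Rightarrow> 's"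
    and \<rr> :: "int list \<Rightarrow> 'w \<Rightarrow> real"
    and R :: "int list \<Rightarrow> real \<Rightarrow> 'w \<Rightarrow> real"
    and \<X> :: "nat \<Rightarrow> nat \<Rightarrow> int list \<Rightarrow> real \<Rightarrow> 'w \<Rightarrow> real ^ 'd"
    and RV :: "nat \<Rightarrow> nat \<Rightarrow> nat"
  assumes T: "T \<ge> 0" and L: "L \<ge> 0"
    and nrm: "is_norm nrm"
    and F_meas: "F \<in> borel \<Otimes>\<^sub>M S \<rightarrow>\<^sub>M borel"
    and F_lip: "\<And>x y s. s \<in> space S \<Longrightarrow> nrm (F (x, s) - F (y, s)) \<le> L * nrm (x - y)"
    and P: "prob_space P"
    and Z_indep: "prob_space.indep_vars P (\<lambda>_. S) Z Theta"
    and Z_distr: "\<And>\<theta> \<eta>. \<theta> \<in> Theta \<Longrightarrow> \<eta> \<in> Theta \<Longrightarrow> distr P S (Z \<theta>) = distr P S (Z \<eta>)"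
    and F_xi: "(\<integral>\<^sup>+\<omega>. ennreal ((nrm (F (\<xi>, Z [0] \<omega>)))\<^sup>2) \<partial>P) < \<infinity>"
    and r_range: "\<And>\<theta> \<omega>. \<theta> \<in> Theta \<Longrightarrow> \<omega> \<in> space P \<Longrightarrow> \<rr> \<theta> \<omega> \<in> {0..1}"
    and r_indep: "prob_space.indep_vars P (\<lambda>_. borel) \<rr> Theta"
    and r_unif: "\<And>\<theta>. \<theta> \<in> Theta \<Longrightarrow> distr P borel (\<rr> \<theta>) = uniform_measure lborel {0..1}"
    and R: "\<And>\<theta> t \<omega>. \<theta> \<in> Theta \<Longrightarrow> t \<in> {0..T} \<Longrightarrow> \<omega> \<in> space P \<Longrightarrow> R \<theta> t \<omega> = \<rr> \<theta> \<omega> * t"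
    and rZ_indep:
      "indep_rvs P
         (\<Pi>\<^sub>M \<theta>\<in>Theta. borel) (\<lambda>\<omega>. \<lambda>\<theta>\<in>Theta. \<rr> \<theta> \<omega>)
         (\<Pi>\<^sub>M \<theta>\<in>Theta. S) (\<lambda>\<omega>. \<lambda>\<theta>\<in>Theta. Z \<theta> \<omega>)"
    and X_rec:
      "\<And>n m \<theta> t \<omega>. m \<ge> 1 \<Longrightarrow> \<theta> \<in> Theta \<Longrightarrow> t \<in> {0..T} \<Longrightarrow> \<omega> \<in> space P \<Longrightarrow>
         \<X> n m \<theta> t \<omega> =
           (\<Sum>l=1..n-1. (t / real m ^ (n - l)) *\<^sub>R
              (\<Sum>k=1..m^(n-l).
                 F (\<X> l m (\<theta> @ [int l, int k]) (R (\<theta> @ [int l, int k]) t \<omega>) \<omega>,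
                    Z (\<theta> @ [int l, int k]) \<omega>)
               - F (\<X> (l - 1) m (\<theta> @ [int l, - int k]) (R (\<theta> @ [int l, int k]) t \<omega>) \<omega>,
                    Z (\<theta> @ [int l, int k]) \<omega>)))
         + (t * indicator {1..} n / real m ^ n) *\<^sub>R
              (\<Sum>k=1..m^n. F (\<xi>, Z (\<theta> @ [0, int k]) \<omega>))
         + \<xi>"
    and RV_0: "\<And>m. m \<ge> 1 \<Longrightarrow> RV 0 m = 0"
    and RV_rec: "\<And>n m. n \<ge> 1 \<Longrightarrow> m \<ge> 1 \<Longrightarrow>
         RV n m \<le> m ^ n + (\<Sum>l=1..n-1. m ^ (n - l) * (1 + RV l m + RV (l - 1) m))"
  shows
    "(\<exists>!X. X \<in> cont_paths T \<and>
        (\<forall>t\<in>{0..T}. X t = \<xi> + (LINT r:{0..t}|lborel. (LINT \<omega>|P. F (X r, Z [0] \<omega>))))) \<and>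
     (\<forall>X. X \<in> cont_paths T \<and>
        (\<forall>t\<in>{0..T}. X t = \<xi> + (LINT r:{0..t}|lborel. (LINT \<omega>|P. F (X r, Z [0] \<omega>)))) \<longrightarrow>
        (\<exists>(c :: real \<Rightarrow> real) (N :: real \<Rightarrow> nat).
           (\<forall>\<delta>>0. c \<delta> \<ge> 0) \<and>
           (\<forall>\<epsilon>\<in>{0<..1}. N \<epsilon> \<ge> 1) \<and>
           (\<forall>\<delta>>0. \<forall>\<epsilon>\<in>{0<..1}.
              real (\<Sum>n=1..N \<epsilon> + \<NN>. RV n n) \<le> c \<delta> * \<epsilon> powr (- (2 + \<delta>)) \<and>
              (SUP n\<in>{N \<epsilon>..}.
                 ennsqrt (\<integral>\<^sup>+\<omega>. ennreal ((nrm (X T - \<X> n n [0] T \<omega>))\<^sup>2) \<partial>P)) \<le> ennreal \<epsilon>)))"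
proof -
  interpret prob_space P by (rule P)
  obtain a b where a: "a > 0" and b: "b > 0" and nrm_le: "\<And>x. nrm x \<le> b * norm x"
    and le_nrm: "\<And>x. norm x \<le> a * nrm x" and nrm_cont: "continuous_on UNIV nrm"
    using is_norm_equivalent[OF nrm] by metis
  have nrm_nonneg: "nrm x \<ge> 0" for x using nrm by (simp add: is_norm_def)
  \<comment> \<open>The Lipschitz constant in the Euclidean norm: \<open>b\<close> compares the
    norms of the arguments, \<open>a\<close> those of the values.\<close>
  define K where "K = a * (L * b)"
  have K: "K \<ge> 0" using a b L by (simp add: K_def)
  have F_lip': "norm (F (x, s) - F (y, s)) \<le> K * norm (x - y)" if "s \<in> space S" for x y s
  proof -
    have "norm (F (x, s) - F (y, s)) \<le> a * nrm (F (x, s) - F (y, s))" by (rule le_nrm)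
    also have "\<dots> \<le> a * (L * nrm (x - y))" using F_lip[OF that] a by (intro mult_left_mono) auto
    also have "\<dots> \<le> a * (L * (b * norm (x - y)))" using nrm_le a L by (intro mult_left_mono) auto
    finally show ?thesis by (simp add: K_def mult_ac)
  qed
  define \<nu> where "\<nu> = distr P S (Z [0])"
  have Th0: "[0] \<in> Theta" by (simp add: Theta_iff)
  have Z_meas: "Z \<theta> \<in> P \<rightarrow>\<^sub>M S" if "\<theta> \<in> Theta" for \<theta>
    using Z_indep that by (auto simp: indep_vars_def2)
  note [measurable] = Z_meas[OF Th0] F_meas borel_measurable_continuous_onI[OF nrm_cont]
  have prob_nu: "prob_space \<nu>" unfolding \<nu>_def by (rule prob_space_distr) measurable
  interpret nu: prob_space \<nu> by (rule prob_nu)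
  have sets_nu [measurable_cong]: "sets \<nu> = sets S" by (simp add: \<nu>_def)
  have space_nu: "space \<nu> = space S" by (simp add: \<nu>_def)
  have F_xi': "(\<integral>\<^sup>+s. ennreal ((norm (F (\<xi>, s)))\<^sup>2) \<partial>\<nu>) < \<infinity>"
  proof -
    have "(\<integral>\<^sup>+s. ennreal ((norm (F (\<xi>, s)))\<^sup>2) \<partial>\<nu>) = (\<integral>\<^sup>+\<omega>. ennreal ((norm (F (\<xi>, Z [0] \<omega>)))\<^sup>2) \<partial>P)"
      unfolding \<nu>_def by (rule nn_integral_distr) measurable
    also have "\<dots> \<le> (\<integral>\<^sup>+\<omega>. ennreal (a\<^sup>2) * ennreal ((nrm (F (\<xi>, Z [0] \<omega>)))\<^sup>2) \<partial>P)"
      unfolding ennreal_mult'[OF zero_le_power2, symmetric] power_mult_distrib[symmetric]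
      using le_nrm by (intro nn_integral_mono ennreal_leI power_mono) auto
    also have "\<dots> = ennreal (a\<^sup>2) * (\<integral>\<^sup>+\<omega>. ennreal ((nrm (F (\<xi>, Z [0] \<omega>)))\<^sup>2) \<partial>P)"
      by (rule nn_integral_cmult) measurable
    also have "\<dots> < \<infinity>" using F_xi by (simp add: ennreal_mult_less_top)
    finally show ?thesis .
  qed
  define f where "f x = (LINT s|\<nu>. F (x, s))" for x
  have f_eq: "(LINT \<omega>|P. F (x, Z [0] \<omega>)) = f x" for x
    unfolding f_def \<nu>_def by (rule integral_distr[symmetric]) measurable
  have F_int: "integrable \<nu> (\<lambda>s. F (x, s))" for x
  proof (rule Bochner_Integration.integrable_bound)
    have "integrable \<nu> (\<lambda>s. (norm (F (\<xi>, s)))\<^sup>2)"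
      by (rule integrableI_nonneg) (use F_xi' in auto)
    then have "integrable \<nu> (\<lambda>s. F (\<xi>, s))"
      by (rule nu.integrable_norm_sq[rotated]) measurable
    then show "integrable \<nu> (\<lambda>s. norm (F (\<xi>, s)) + K * norm (x - \<xi>))" by simp
    show "AE s in \<nu>. norm (F (x, s)) \<le> norm (norm (F (\<xi>, s)) + K * norm (x - \<xi>))"
    proof (rule AE_I2)
      fix s assume "s \<in> space \<nu>"
      then have "norm (F (x, s) - F (\<xi>, s)) \<le> K * norm (x - \<xi>)" by (intro F_lip') (simp add: space_nu)
      then show "norm (F (x, s)) \<le> norm (norm (F (\<xi>, s)) + K * norm (x - \<xi>))"
        using norm_triangle_ineq2[of "F (x, s)" "F (\<xi>, s)"] by simp
    qed
  qed measurable
  have f_lip: "norm (f x - f y) \<le> K * norm (x - y)" for x y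
  proof -
    have "norm (f x - f y) = norm (LINT s|\<nu>. F (x, s) - F (y, s))"
      using F_int by (simp add: f_def)
    also have "\<dots> \<le> (LINT s|\<nu>. norm (F (x, s) - F (y, s)))" by (rule integral_norm_bound)
    also have "\<dots> \<le> (LINT s|\<nu>. K * norm (x - y))"
      using F_int by (intro integral_mono) (auto simp: space_nu F_lip')
    finally show ?thesis by (simp add: nu.prob_space)
  qed
  define W where "W \<theta> \<omega> = (\<rr> \<theta> \<omega>, Z \<theta> \<omega>)" for \<theta> \<omega>
  have W_indep: "indep_vars (\<lambda>_. borel \<Otimes>\<^sub>M S) W Theta"
    using indep_vars_Pair[OF r_indep Z_indep rZ_indep] by (simp add: W_def[abs_def])
  have W_distr: "distr P (borel \<Otimes>\<^sub>M S) (W \<theta>) = uniform_measure lborel {0..1} \<Otimes>\<^sub>M \<nu>" if "\<theta> \<in> Theta" for \<theta>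
    using distr_Pair_indep_rvs_component[OF rZ_indep that] r_unif[OF that] Z_distr[OF that Th0]
    by (simp add: W_def[abs_def] \<nu>_def)

  have part2: "\<exists>(c :: real \<Rightarrow> real) (N :: real \<Rightarrow> nat).
           (\<forall>\<delta>>0. c \<delta> \<ge> 0) \<and>
           (\<forall>\<epsilon>\<in>{0<..1}. N \<epsilon> \<ge> 1) \<and>
           (\<forall>\<delta>>0. \<forall>\<epsilon>\<in>{0<..1}.
              real (\<Sum>n=1..N \<epsilon> + \<NN>. RV n n) \<le> c \<delta> * \<epsilon> powr (- (2 + \<delta>)) \<and>
              (SUP n\<in>{N \<epsilon>..}.
                 ennsqrt (\<integral>\<^sup>+\<omega>. ennreal ((nrm (X T - \<X> n n [0] T \<omega>))\<^sup>2) \<partial>P)) \<le> ennreal \<epsilon>)"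
    if X: "X \<in> cont_paths T" and X_eq: "\<And>t. t \<in> {0..T} \<Longrightarrow> X t = \<xi> + (LINT r:{0..t}|lborel. f (X r))" for X
  proof -
    have X_cont: "continuous_on {0..T} X" using X by (simp add: cont_paths_def)
    \<comment> \<open>Constant extension of the solution beyond {0..T}, as the locale asks for a
      path on the whole line.\<close>
    define Y where "Y s = X (max 0 (min T s))" for s
    have Y_X: "Y s = X s" if "s \<in> {0..T}" for s using that by (simp add: Y_def)
    have Y_cont: "continuous_on UNIV Y"
      unfolding Y_def by (rule continuous_on_compose2[OF X_cont]) (use T in \<open>auto intro!: continuous_intros\<close>)
    have "bounded ((\<lambda>s. X s - \<xi>) ` {0..T})"
      by (intro compact_imp_bounded compact_continuous_image continuous_intros X_cont compact_Icc)
    then obtain C where "\<And>x. x \<in> (\<lambda>s. X s - \<xi>) ` {0..T} \<Longrightarrow> norm x \<le> C" unfolding bounded_iff by blast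
    then have Y_bound: "norm (Y s - \<xi>) \<le> C" for s using T by (simp add: Y_def)
    interpret mlp_setting P T K C \<xi> S \<nu> F W Y
    proof
      show "fst (W \<theta> \<omega>) \<in> {0..1}" if "\<theta> \<in> Theta" "\<omega> \<in> space P" for \<theta> \<omega>
        using r_range[OF that] by (simp add: W_def)
      show "Y t = \<xi> + (LINT r:{0..t}|lborel. (LINT s|\<nu>. F (Y r, s)))" if "t \<in> {0..T}" for t
      proof -
        have "(LINT r:{0..t}|lborel. f (X r)) = (LINT r:{0..t}|lborel. f (Y r))"
          using that by (intro set_lebesgue_integral_cong) (auto simp: Y_X)
        then show ?thesis using X_eq[OF that] Y_X[OF that] by (simp add: f_def)
      qed
    qed (fact T K F_meas F_lip' prob_nu sets_nu F_xi' W_indep W_distr Y_cont Y_bound)+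
    \<comment> \<open>The recursion is assumed at every outcome, so it determines the iterates
      pointwise and not just almost surely.\<close>
    have \<X>_eq: "\<X> n m \<theta> t \<omega> = \<Phi> m n t (D \<theta> \<omega>)"
      if "m \<ge> 1" "\<theta> \<in> Theta" "t \<in> {0..T}" "\<omega> \<in> space P" for n m \<theta> t \<omega>
      using that
    proof (induction n arbitrary: \<theta> t rule: less_induct)
      case (less n)
      have node: "\<theta> @ [i, j] \<in> Theta" for i j by (simp add: Theta_iff)
      have val: "D \<theta> \<omega> [i, j] = (\<rr> (\<theta> @ [i, j]) \<omega>, Z (\<theta> @ [i, j]) \<omega>)" for i j
        by (simp add: D_def subtree_def W_def Theta_iff)
      have sub: "subtree [i, j] (D \<theta> \<omega>) = D (\<theta> @ [i, j]) \<omega>" for i j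
        by (simp add: D_def subtree_subtree)
      have R_eq: "R (\<theta> @ [i, j]) t \<omega> = \<rr> (\<theta> @ [i, j]) \<omega> * t" for i j
        using less.prems by (intro R node)
      have R_in: "\<rr> (\<theta> @ [i, j]) \<omega> * t \<in> {0..T}" for i j
      proof -
        have r: "\<rr> (\<theta> @ [i, j]) \<omega> \<in> {0..1}" using less.prems by (intro r_range node)
        then have "\<rr> (\<theta> @ [i, j]) \<omega> * t \<le> t" using less.prems by (simp add: mult_left_le_one_le)
        also have "t \<le> T" using less.prems by simp
        finally show ?thesis using r less.prems by simp
      qed
      \<comment> \<open>The nodes for the data and for the time are kept apart, because the
        subtracted approximation runs on (l,-k) at the time drawn at (l,k).\<close>
      have IH: "\<X> l m (\<theta> @ [i, j]) (R (\<theta> @ [i', j']) t \<omega>) \<omega> = \<Phi> m l (\<rr> (\<theta> @ [i', j']) \<omega> * t) (D (\<theta> @ [i, j]) \<omega>)"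
        if "l < n" for l i j i' j'
        unfolding R_eq using less.prems by (intro less.IH that node R_in)
      define H where "H l k = F (\<Phi> m l (\<rr> (\<theta> @ [int l, int k]) \<omega> * t) (D (\<theta> @ [int l, int k]) \<omega>), Z (\<theta> @ [int l, int k]) \<omega>)
         - (if l = 0 then 0 else F (\<Phi> m (l - 1) (\<rr> (\<theta> @ [int l, int k]) \<omega> * t) (D (\<theta> @ [int l, - int k]) \<omega>), Z (\<theta> @ [int l, int k]) \<omega>))"
        for l k
      have \<Phi>: "\<Phi> m n t (D \<theta> \<omega>) = \<xi> + (\<Sum>l<n. (t / real m ^ (n - l)) *\<^sub>R (\<Sum>k=1..m ^ (n - l). H l k))"
        by (subst mlp.simps) (simp only: val sub H_def[abs_def] fst_conv snd_conv)
      have tail: "(\<Sum>l=1..n-1. (t / real m ^ (n - l)) *\<^sub>R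
              (\<Sum>k=1..m^(n-l).
                 F (\<X> l m (\<theta> @ [int l, int k]) (R (\<theta> @ [int l, int k]) t \<omega>) \<omega>,
                    Z (\<theta> @ [int l, int k]) \<omega>)
               - F (\<X> (l - 1) m (\<theta> @ [int l, - int k]) (R (\<theta> @ [int l, int k]) t \<omega>) \<omega>,
                    Z (\<theta> @ [int l, int k]) \<omega>)))
          = (\<Sum>l=1..n-1. (t / real m ^ (n - l)) *\<^sub>R (\<Sum>k=1..m ^ (n - l). H l k))"
      proof (intro sum.cong refl arg_cong2[where f="(*\<^sub>R)"])
        fix l k assume "l \<in> {1..n-1}"
        then have l: "l < n" "l - 1 < n" "l \<noteq> 0" by auto
        show "F (\<X> l m (\<theta> @ [int l, int k]) (R (\<theta> @ [int l, int k]) t \<omega>) \<omega>, Z (\<theta> @ [int l, int k]) \<omega>)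
               - F (\<X> (l - 1) m (\<theta> @ [int l, - int k]) (R (\<theta> @ [int l, int k]) t \<omega>) \<omega>, Z (\<theta> @ [int l, int k]) \<omega>) = H l k"
          unfolding H_def IH[OF l(1)] IH[OF l(2)] using l(3) by simp
      qed
      \<comment> \<open>Since level 0 is the constant \<xi>, this term is the summand
        \<open>l = 0\<close> of \<open>mlp\<close>; the indicator removes it when
        \<open>n = 0\<close>, matching the empty sum.\<close>
      have head: "(t * indicator {1..} n / real m ^ n) *\<^sub>R (\<Sum>k=1..m^n. F (\<xi>, Z (\<theta> @ [0, int k]) \<omega>))
          = (if n = 0 then 0 else (t / real m ^ (n - 0)) *\<^sub>R (\<Sum>k=1..m ^ (n - 0). H 0 k))"
        by (simp add: H_def)
      have "{..<n} = (if n = 0 then {} else insert 0 {1..n-1})" by auto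
      then show ?case
        unfolding X_rec[OF less.prems] tail head \<Phi> by (cases "n = 0") simp_all
    qed
    define B where "B = T\<^sup>2 * C0 + C\<^sup>2"
    \<comment> \<open>At m = n the weight \<open>exp (n * T)\<close> is \<open>exp T ^ n\<close> and
      is absorbed here.\<close>
    define G where "G = (2 + 10 * (K\<^sup>2 * T)) * exp T"
    \<comment> \<open>The added 1 keeps the constant positive, as the complexity lemma takes its
      logarithm.\<close>
    define E where "E = b\<^sup>2 * B + 1"
    have B: "B \<ge> 0" using C0_nonneg by (simp add: B_def)
    have G: "G > 0" unfolding G_def using T by (intro mult_pos_pos add_pos_nonneg) auto
    have E: "E > 0" unfolding E_def using B by (intro add_nonneg_pos) auto
    have error: "(\<integral>\<^sup>+\<omega>. ennreal ((nrm (X T - \<X> n n [0] T \<omega>))\<^sup>2) \<partial>P) \<le> ennreal (E * G ^ n / real n ^ n)"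
      if n: "n \<ge> 1" for n
    proof -
      have TT: "T \<in> {0..T}" using T by simp
      have "(\<integral>\<^sup>+\<omega>. ennreal ((nrm (X T - \<X> n n [0] T \<omega>))\<^sup>2) \<partial>P)
          \<le> (\<integral>\<^sup>+\<omega>. ennreal (b\<^sup>2) * ennreal ((norm (\<Phi> n n T (D [0] \<omega>) - Y T))\<^sup>2) \<partial>P)"
      proof (rule nn_integral_mono)
        fix \<omega> assume \<omega>: "\<omega> \<in> space P"
        have "nrm (X T - \<X> n n [0] T \<omega>) \<le> b * norm (\<Phi> n n T (D [0] \<omega>) - Y T)"
          using nrm_le[of "X T - \<X> n n [0] T \<omega>"] unfolding \<X>_eq[OF n Th0 TT \<omega>] Y_X[OF TT]
          by (simp add: norm_minus_commute)
        then show "ennreal ((nrm (X T - \<X> n n [0] T \<omega>))\<^sup>2) \<le> ennreal (b\<^sup>2) * ennreal ((norm (\<Phi> n n T (D [0] \<omega>) - Y T))\<^sup>2)"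
          unfolding ennreal_mult'[OF zero_le_power2, symmetric] power_mult_distrib[symmetric]
          by (intro ennreal_leI power_mono nrm_nonneg)
      qed
      also have "\<dots> = ennreal (b\<^sup>2) * err n n T"
        unfolding err_eq_expectation[of n n T "[0]", symmetric] by (rule nn_integral_cmult) measurable
      also have "\<dots> \<le> ennreal (b\<^sup>2) * ennreal (B * (2 + 10 * (K\<^sup>2 * T)) ^ n / real n ^ n * exp (real n * T))"
        using err_bound[OF n TT] unfolding B_def by (intro mult_left_mono) auto
      also have "\<dots> = ennreal (b\<^sup>2 * (B * (2 + 10 * (K\<^sup>2 * T)) ^ n / real n ^ n * exp (real n * T)))"
        by (rule ennreal_mult'[symmetric]) simp
      also have "b\<^sup>2 * (B * (2 + 10 * (K\<^sup>2 * T)) ^ n / real n ^ n * exp (real n * T)) = (b\<^sup>2 * B) * (G ^ n / real n ^ n)"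
        by (simp add: G_def power_mult_distrib exp_of_nat_mult)
      also have "\<dots> \<le> E * (G ^ n / real n ^ n)"
        using G by (intro mult_right_mono) (auto simp: E_def)
      finally show ?thesis by (simp add: ennreal_leI)
    qed
    have cost: "RV n n \<le> (4 * n) ^ n" if "n \<ge> 1" for n
      using that by (intro evaluation_count_bound[of n "\<lambda>l. RV l n"] RV_0 RV_rec)
    obtain c :: "real \<Rightarrow> real" and N :: "real \<Rightarrow> nat" where cN: "\<forall>\<delta>>0. c \<delta> \<ge> 0" "\<forall>\<epsilon>\<in>{0<..1}. N \<epsilon> \<ge> 1"
      and bounds: "\<forall>\<delta>>0. \<forall>\<epsilon>\<in>{0<..1}. real (\<Sum>n=1..N \<epsilon> + \<NN>. RV n n) \<le> c \<delta> * \<epsilon> powr (- (2 + \<delta>)) \<and>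
        (\<forall>n\<ge>N \<epsilon>. E * G ^ n / real n ^ n \<le> \<epsilon>\<^sup>2)"
      using complexity_of_superexponential_error[OF E G, of "\<lambda>n. RV n n" \<NN>] cost by blast
    show ?thesis
    proof (rule exI[of _ c], rule exI[of _ N], intro conjI cN allI impI ballI)
      fix \<delta> \<epsilon> :: real assume \<delta>: "\<delta> > 0" and \<epsilon>: "\<epsilon> \<in> {0<..1}"
      show "real (\<Sum>n=1..N \<epsilon> + \<NN>. RV n n) \<le> c \<delta> * \<epsilon> powr (- (2 + \<delta>))"
        using bounds \<delta> \<epsilon> by blast
      show "(SUP n\<in>{N \<epsilon>..}. ennsqrt (\<integral>\<^sup>+\<omega>. ennreal ((nrm (X T - \<X> n n [0] T \<omega>))\<^sup>2) \<partial>P)) \<le> ennreal \<epsilon>"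
      proof (rule SUP_least)
        fix n assume n: "n \<in> {N \<epsilon>..}"
        then have "n \<ge> 1" using cN(2) \<epsilon> by force
        moreover have "E * G ^ n / real n ^ n \<le> \<epsilon>\<^sup>2" using bounds \<delta> \<epsilon> n by simp
        ultimately have "(\<integral>\<^sup>+\<omega>. ennreal ((nrm (X T - \<X> n n [0] T \<omega>))\<^sup>2) \<partial>P) \<le> ennreal (\<epsilon>\<^sup>2)"
          using error ennreal_leI order_trans by blast
        then show "ennsqrt (\<integral>\<^sup>+\<omega>. ennreal ((nrm (X T - \<X> n n [0] T \<omega>))\<^sup>2) \<partial>P) \<le> ennreal \<epsilon>"
          using \<epsilon> by (intro ennsqrt_le) auto
      qed
    qed
  qed
  have part1: "\<exists>!X. X \<in> cont_paths T \<and> (\<forall>t\<in>{0..T}. X t = \<xi> + (LINT r:{0..t}|lborel. f (X r)))"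
    by (rule integral_equation_unique_solution[OF T K f_lip])
  show ?thesis unfolding f_eq using part1 part2 by blast
qed

end
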